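(* Let $n\ge 3$ be a given integer. The triangle graph $\mathcal{T}(G)$ of a graph $G$ does not contain an induced cycle of length $n$ if and only if $G$ has no (not necessarily induced) subgraph isomorphic to any of the following forbidden ones. (a) If $n=3$, the forbidden subgraphs are $K_4$ and $K_5-K_3$. (b) If $n=4$, the only forbidden subgraph is $W_4$. (c) If $n=5$, the forbidden subgraphs are $W_5$ and $C_5^2\cong K_5$. (d) If $n=6$, the forbidden subgraphs are $W_6$, $C_6^2$, $K_6-K_3$, $K_6-P_4$, and the graph obtained from $C_5^2\cong K_5$ by a weak edge splitting. (e) If $n\ge 7$, the forbidden subgraphs are: (i) $W_n$; (ii) graphs obtained from $C_m^2$ by $n-m$ weak edge splittings ($5\le m\le n$); (iii) graphs obtained from $K_6-K_3$ by $n-6$ weak edge splittings; (iv) graphs obtained from $K_6-P_4$ by $n-6$ weak edge splittings; (v) graphs obtained from any graphs described in (ii)–(iv) by any number of weak vertex stickings.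
   Context: All graphs are finite, simple and undirected. A triangle is a $K_3$ subgraph. The triangle graph $\mathcal{T}(G)$ of $G$ has one vertex for each triangle of $G$, two vertices being adjacent if and only if the corresponding triangles share an edge. $W_n=K_1\vee C_n$ is the $n$-wheel. $C_m^2$ is the square of the $m$-cycle (vertices adjacent iff at distance $1$ or $2$ in $C_m$). $K_n-F$ is the graph obtained from $K_n$ by deleting the edge set of a subgraph isomorphic to $F$; $P_4$ is the path on 4 vertices. The weak operations are applied to a graph $H$ together with a specified induced cycle of $\mathcal{T}(H)$ which does not consist of three triangles of $H$ sharing a common edge. The triangles of $H$ corresponding to the vertices of this cycle are called cycle-triangles; an edge is private if it belongs to exactly one cycle-triangle. The starting graphs $C_m^2$, $K_6-K_3$, $K_6-P_4$ are taken with a specified induced cycle in their triangle graph of length $m$, $6$, $6$, respectively. Weak edge splitting: for a private edge $e=uv$ belonging to the cycle-triangle $uvx$, delete the edge $uv$, introduce a new vertex $w$ and add the edges $uw,wv,wx$. In the specified cycle, the triangle $uvx$ is replaced by the two consecutive triangles $uwx$, $wvx$, giving the specified cycle (one longer) of the new graph. Weak vertex sticking: for two vertices $u,v$ at distance at least $3$ apart, remove $u$ and $v$ and introduce a new vertex $w$ adjacent to all of $N(u)\cup N(v)$, where $N(\cdot)$ is the open neighborhood. The specified cycle is kept, with $u$ and $v$ replaced by $w$ in the cycle-triangles. *)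

theory Defs
  imports Main "HOL-Library.Extended_Nat"
begin

datatype 'a graph = Graph (verts: "'a set") (edges: "'a set set")

definition simple_graph :: "'a graph \<Rightarrow> bool" where
  "simple_graph G \<longleftrightarrow>
     finite (verts G) \<and> (\<forall>e\<in>edges G. e \<subseteq> verts G \<and> card e = 2)"

definition neighborhood :: "'a graph \<Rightarrow> 'a \<Rightarrow> 'a set" where
  "neighborhood G v = {x \<in> verts G. {v, x} \<in> edges G}"

definition subgraph :: "'a graph \<Rightarrow> 'a graph \<Rightarrow> bool" where
  "subgraph H G \<longleftrightarrow> simple_graph H \<and> verts H \<subseteq> verts G \<and> edges H \<subseteq> edges G"

definition induced_subgraph :: "'a graph \<Rightarrow> 'a set \<Rightarrow> 'a graph" where
  "induced_subgraph G S = Graph S {e \<in> edges G. e \<subseteq> S}"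

definition isomorphic :: "'a graph \<Rightarrow> 'b graph \<Rightarrow> bool" where
  "isomorphic G H \<longleftrightarrow>
     (\<exists>f. bij_betw f (verts G) (verts H) \<and>
          (\<forall>x\<in>verts G. \<forall>y\<in>verts G. {x, y} \<in> edges G \<longleftrightarrow> {f x, f y} \<in> edges H))"

definition has_subgraph_isomorphic_to :: "'a graph \<Rightarrow> 'b graph \<Rightarrow> bool" where
  "has_subgraph_isomorphic_to G H \<longleftrightarrow> (\<exists>K. subgraph K G \<and> isomorphic K H)"

definition walk :: "'a graph \<Rightarrow> 'a list \<Rightarrow> bool" where
  "walk G p \<longleftrightarrow>
     p \<noteq> [] \<and> set p \<subseteq> verts G \<and> successively (\<lambda>x y. {x, y} \<in> edges G) p"

text \<open>The distance is \<open>\<infinity>\<close> (the infimum of the empty set) between different components.\<close>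

definition gdist :: "'a graph \<Rightarrow> 'a \<Rightarrow> 'a \<Rightarrow> enat" where
  "gdist G x y = (INF p\<in>{p. walk G p \<and> hd p = x \<and> last p = y}. enat (length p - 1))"

definition complete_graph :: "nat \<Rightarrow> nat graph" where
  "complete_graph n = Graph {..<n} {{i, j} |i j. i < n \<and> j < n \<and> i \<noteq> j}"

definition path_graph :: "nat \<Rightarrow> nat graph" where
  "path_graph n = Graph {..<n} {{i, Suc i} |i. Suc i < n}"

text \<open>Meant for \<open>n \<ge> 3\<close>.\<close>

definition cycle_graph :: "nat \<Rightarrow> nat graph" where
  "cycle_graph n = Graph {..<n} {{i, Suc i mod n} |i. i < n}"

text \<open>Meant for graphs with disjoint vertex sets.\<close>

definition join_graph :: "'a graph \<Rightarrow> 'a graph \<Rightarrow> 'a graph" where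
  "join_graph G H =
     Graph (verts G \<union> verts H)
           (edges G \<union> edges H \<union> {{x, y} |x y. x \<in> verts G \<and> y \<in> verts H})"

definition wheel_graph :: "nat \<Rightarrow> nat graph" where
  "wheel_graph n = join_graph (Graph {n} {}) (cycle_graph n)"

definition square_graph :: "'a graph \<Rightarrow> 'a graph" where
  "square_graph G =
     Graph (verts G)
           {{x, y} |x y. x \<in> verts G \<and> y \<in> verts G \<and> (gdist G x y = 1 \<or> gdist G x y = 2)}"

definition delete_edges :: "'a graph \<Rightarrow> 'a graph \<Rightarrow> 'a graph" where
  "delete_edges G F = Graph (verts G) (edges G - edges F)"

text \<open>A triangle is represented by its vertex set, which determines it in a simple graph.\<close>

definition triangles :: "'a graph \<Rightarrow> 'a set set" where
  "triangles G =
     {t. t \<subseteq> verts G \<and> card t = 3 \<and> (\<forall>x\<in>t. \<forall>y\<in>t. x \<noteq> y \<longrightarrow> {x, y} \<in> edges G)}"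

definition triangle_graph :: "'a graph \<Rightarrow> 'a set graph" where
  "triangle_graph G =
     Graph (triangles G)
           {{s, t} |s t. s \<in> triangles G \<and> t \<in> triangles G \<and> s \<noteq> t \<and>
                         (\<exists>e\<in>edges G. e \<subseteq> s \<and> e \<subseteq> t)}"

text \<open>An induced cycle is determined by, and is identified with, its vertex set \<open>S\<close>.\<close>

definition induced_cycle :: "'a graph \<Rightarrow> nat \<Rightarrow> 'a set \<Rightarrow> bool" where
  "induced_cycle G n S \<longleftrightarrow>
     3 \<le> n \<and> S \<subseteq> verts G \<and> isomorphic (induced_subgraph G S) (cycle_graph n)"

text \<open>
  The operations act on pairs \<open>(H, S)\<close>, where \<open>S\<close> is the set of cycle-triangles, i.e. the
  vertex set of the specified induced cycle of the triangle graph of \<open>H\<close>.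
\<close>

definition specified_cycle :: "'a graph \<Rightarrow> 'a set set \<Rightarrow> bool" where
  "specified_cycle H S \<longleftrightarrow>
     (\<exists>m. induced_cycle (triangle_graph H) m S) \<and>
     \<not> (card S = 3 \<and> (\<exists>e\<in>edges H. \<forall>t\<in>S. e \<subseteq> t))"

definition private_edge :: "'a graph \<Rightarrow> 'a set set \<Rightarrow> 'a set \<Rightarrow> bool" where
  "private_edge H S e \<longleftrightarrow> e \<in> edges H \<and> (\<exists>!t. t \<in> S \<and> e \<subseteq> t)"

inductive weak_edge_splitting ::
    "'a graph \<times> 'a set set \<Rightarrow> 'a graph \<times> 'a set set \<Rightarrow> bool" where
  "weak_edge_splitting (H, S)
     (Graph (insert w (verts H)) (edges H - {{u, v}} \<union> {{u, w}, {w, v}, {w, x}}),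
      S - {{u, v, x}} \<union> {{u, w, x}, {w, v, x}})"
  if "simple_graph H" and "specified_cycle H S" and "{u, v, x} \<in> S" and "card {u, v, x} = 3"
    and "private_edge H S {u, v}" and "w \<notin> verts H"

inductive weak_vertex_sticking ::
    "'a graph \<times> 'a set set \<Rightarrow> 'a graph \<times> 'a set set \<Rightarrow> bool" where
  "weak_vertex_sticking (H, S)
     (Graph (insert w (verts H - {u, v}))
            ({e \<in> edges H. u \<notin> e \<and> v \<notin> e} \<union> {{w, x} |x. x \<in> neighborhood H u \<union> neighborhood H v}),
      (\<lambda>t. (\<lambda>x. if x = u \<or> x = v then w else x) ` t) ` S)"
  if "simple_graph H" and "specified_cycle H S" and "u \<in> verts H" and "v \<in> verts H"
    and "3 \<le> gdist H u v" and "w \<notin> verts H"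

definition splittings :: "nat graph \<Rightarrow> nat \<Rightarrow> nat \<Rightarrow> (nat graph \<times> nat set set) set" where
  "splittings H0 m k =
     {HS. \<exists>S0. induced_cycle (triangle_graph H0) m S0 \<and> (weak_edge_splitting ^^ k) (H0, S0) HS}"

definition split_graphs :: "nat \<Rightarrow> (nat graph \<times> nat set set) set" where
  "split_graphs n =
     (\<Union>m\<in>{5..n}. splittings (square_graph (cycle_graph m)) m (n - m))
     \<union> splittings (delete_edges (complete_graph 6) (complete_graph 3)) 6 (n - 6)
     \<union> splittings (delete_edges (complete_graph 6) (path_graph 4)) 6 (n - 6)"

definition stuck_graphs :: "nat \<Rightarrow> (nat graph \<times> nat set set) set" where
  "stuck_graphs n = {HS'. \<exists>HS\<in>split_graphs n. weak_vertex_sticking\<^sup>*\<^sup>* HS HS'}"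

text \<open>Up to isomorphism; only relevant for \<open>n \<ge> 3\<close>.\<close>

definition forbidden_subgraphs :: "nat \<Rightarrow> nat graph set" where
  "forbidden_subgraphs n =
     (if n = 3 then
        {complete_graph 4, delete_edges (complete_graph 5) (complete_graph 3)}
      else if n = 4 then
        {wheel_graph 4}
      else if n = 5 then
        {wheel_graph 5, square_graph (cycle_graph 5)}
      else if n = 6 then
        {wheel_graph 6, square_graph (cycle_graph 6),
         delete_edges (complete_graph 6) (complete_graph 3),
         delete_edges (complete_graph 6) (path_graph 4)}
        \<union> fst ` splittings (square_graph (cycle_graph 5)) 5 1
      else
        {wheel_graph n} \<union> fst ` split_graphs n \<union> fst ` stuck_graphs n)"

end

theory Submission
  imports Defs
begin

text \<open>
  Two distinct triangles are adjacent in the triangle graph iff they have two vertices in common,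
  so an induced \<open>n\<close>-cycle of the triangle graph is a cyclic sequence of triangles in which
  consecutive ones meet in two vertices and all others in at most one (\<open>triangle_cycle\<close>,
  \<open>induced_cycle_iff\<close>). This description does not refer to the surrounding graph, hence it is
  inherited by supergraphs (\<open>induced_cycle_supergraph\<close>). It is also kept by a weak edge splitting,
  which lengthens the cycle by one, and by a weak vertex sticking, since identifying vertices at
  distance at least three never produces a new common edge of two triangles. Together with explicit
  cycles in the starting graphs this shows that every forbidden subgraph forces an induced cycle.

  Conversely, let \<open>n \<ge> 4\<close> and let \<open>T 0, T 1, \<dots>\<close> be a cycle of \<open>n\<close> triangles in \<open>G\<close>. Call the
  vertex of a triangle that is not in the preceding triangle new. Every triangle also contains the
  new vertex of its predecessor, so \<open>T i = {x i, x (i + 1), z i}\<close> where \<open>x (i + 1)\<close> is new in \<open>T i\<close>,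
  and the third vertex of the next triangle is either kept,
  \<open>z (i + 1) = z i\<close>, or it is \<open>x i\<close>; the latter is called a switch (\<open>triangle_strip_exists\<close>). If
  there is no switch, then \<open>z\<close> is constant and the triangles form a wheel. Otherwise the cyclic word
  of switches determines the strip up to identification of vertices that are far apart, and the
  proof has three parts.

  First, a word is called realizable if a strip with this word and distinct vertices arises from a
  starting graph by splittings. Inserting a non-switch into a word is a weak edge splitting
  (\<open>strip_word_split\<close>), and the words of the starting graphs are \<open>S S \<dots> S\<close> for \<open>C\<^sub>m\<^sup>2\<close>,
  \<open>S N S N S N\<close> for \<open>K\<^sub>6 - K\<^sub>3\<close> and \<open>S N S N S S\<close> for \<open>K\<^sub>6 - P\<^sub>4\<close>, where \<open>S\<close> is a switch and \<open>N\<close> is not.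
  So a word is realizable as soon as it has at least five switches, or four without two opposite
  gaps that are both empty, or three with no empty gap. Secondly, an induced cycle excludes all
  other words, because in those some edge would lie in three triangles or in two triangles that are
  not consecutive, or, with a single switch, the triangle there would be degenerate
  (\<open>realizable_switches\<close>). Thirdly, the realizing strip maps onto the given cycle of triangles,
  injectively on every triangle; two vertices with the same image are at distance at
  least three (\<open>local_map_far\<close>), so they can be stuck together one pair after the other until the
  map is injective (\<open>stickings_to_subgraph\<close>). For \<open>n < 8\<close> there is nothing to identify: every vertex
  of a strip has degree at least three, so two vertices at distance at least three need eight
  vertices (\<open>far_vertices_strip\<close>).

  The case \<open>n = 3\<close> is different because non-consecutive triangles do not exist; it is a direct
  inspection of three triangles that pairwise share an edge (\<open>triangle_3_cycle_subgraph\<close>).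
\<close>

section \<open>Cyclic sequences of triangles\<close>

text \<open>
  A concrete enumeration is easier to modify by splitting and sticking than an isomorphism with a
  cycle. Stating the intersections for \<open>i < j\<close> only keeps modular arithmetic out of the definition;
  the pair \<open>(0, n - 1)\<close> closes the cycle.
\<close>

definition triangle_cycle :: "nat \<Rightarrow> (nat \<Rightarrow> 'a set) \<Rightarrow> bool" where
  "triangle_cycle n t \<longleftrightarrow>
     (\<forall>i<n. card (t i) = 3) \<and>
     (\<forall>i j. i < j \<longrightarrow> j < n \<longrightarrow>
        (if j = Suc i \<or> i = 0 \<and> Suc j = n then card (t i \<inter> t j) = 2
         else card (t i \<inter> t j) \<le> 1))"

lemma triangle_cycle_card: "triangle_cycle n t \<Longrightarrow> i < n \<Longrightarrow> card (t i) = 3"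
  by (simp add: triangle_cycle_def)

lemma triangle_cycle_finite: "triangle_cycle n t \<Longrightarrow> i < n \<Longrightarrow> finite (t i)"
  by (metis triangle_cycle_card card.infinite zero_neq_numeral)

lemma triangle_cycle_cases:
  assumes "triangle_cycle n t" "i < j" "j < n"
  shows "if j = Suc i \<or> i = 0 \<and> Suc j = n then card (t i \<inter> t j) = 2 else card (t i \<inter> t j) \<le> 1"
  using assms unfolding triangle_cycle_def by blast

lemma triangle_cycle_adj:
  assumes "triangle_cycle n t" "i < j" "j < n" "j = Suc i \<or> i = 0 \<and> Suc j = n"
  shows "card (t i \<inter> t j) = 2"
  using triangle_cycle_cases[OF assms(1-3)] unfolding if_P[OF assms(4)] .

lemma triangle_cycle_nonadj:
  assumes "triangle_cycle n t" "i < j" "j < n" "\<not> (j = Suc i \<or> i = 0 \<and> Suc j = n)"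
  shows "card (t i \<inter> t j) \<le> 1"
  using triangle_cycle_cases[OF assms(1-3)] unfolding if_not_P[OF assms(4)] .

lemma card_two_le: "finite A \<Longrightarrow> a \<in> A \<Longrightarrow> b \<in> A \<Longrightarrow> a \<noteq> b \<Longrightarrow> 2 \<le> card A"
  by (metis card_2_iff card_mono empty_subsetI insert_subset)

lemma card_le_1I: "(\<And>a b. a \<in> A \<Longrightarrow> b \<in> A \<Longrightarrow> a = b) \<Longrightarrow> card A \<le> 1"
  by (metis card_le_Suc0_iff_eq card.infinite One_nat_def zero_le)

lemma triangle_cycle_sharing:
  assumes "triangle_cycle n t" "i < n" "j < n" "a \<noteq> b" "{a, b} \<subseteq> t i" "{a, b} \<subseteq> t j" "i < j"
  shows "j = Suc i \<or> i = 0 \<and> Suc j = n"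
proof (rule ccontr)
  assume "\<not> ?thesis"
  then have "card (t i \<inter> t j) \<le> 1" using triangle_cycle_nonadj assms by metis
  moreover have "2 \<le> card (t i \<inter> t j)"
    using assms triangle_cycle_finite[OF assms(1,2)] by (intro card_two_le[of _ a b]) auto
  ultimately show False by simp
qed

lemma triangle_cycle_inj:
  assumes "triangle_cycle n t" shows "inj_on t {..<n}"
proof (rule linorder_inj_onI)
  fix i j assume "i < j" "i \<in> {..<n}" "j \<in> {..<n}"
  then have "card (t i \<inter> t j) \<le> 2"
    using triangle_cycle_adj[OF assms, of i j] triangle_cycle_nonadj[OF assms, of i j] by force
  then show "t i \<noteq> t j" using triangle_cycle_card[OF assms, of i] \<open>i \<in> _\<close> by auto
qed auto

lemma triangle_cycleI:
  assumes "\<And>i. i < n \<Longrightarrow> card (t i) = 3"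
    and "\<And>i j. i < j \<Longrightarrow> j < n \<Longrightarrow> j = Suc i \<or> i = 0 \<and> Suc j = n \<Longrightarrow> card (t i \<inter> t j) = 2"
    and "\<And>i j. i < j \<Longrightarrow> j < n \<Longrightarrow> \<not> (j = Suc i \<or> i = 0 \<and> Suc j = n) \<Longrightarrow> card (t i \<inter> t j) \<le> 1"
  shows "triangle_cycle n t"
  using assms unfolding triangle_cycle_def by (auto simp del: One_nat_def)

lemma triangle_cycle_cong:
  assumes "triangle_cycle n t" "\<And>i. i < n \<Longrightarrow> t' i = t i" shows "triangle_cycle n t'"
proof (rule triangle_cycleI)
  fix i assume "i < n" then show "card (t' i) = 3" using assms triangle_cycle_card by metis
next
  fix i j assume *: "i < j" "j < n" then have **: "t' i = t i" "t' j = t j" using assms(2) by auto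
  show "card (t' i \<inter> t' j) = 2" if "j = Suc i \<or> i = 0 \<and> Suc j = n"
    unfolding ** using triangle_cycle_adj[OF assms(1) * that] .
  show "card (t' i \<inter> t' j) \<le> 1" if "\<not> (j = Suc i \<or> i = 0 \<and> Suc j = n)"
    unfolding ** using triangle_cycle_nonadj[OF assms(1) * that] .
qed

lemma triangle_cycle_rotate1:
  assumes "triangle_cycle n t"
  shows "triangle_cycle n (\<lambda>i. t (Suc i mod n))"
proof (cases "n = 0")
  case True then show ?thesis by (simp add: triangle_cycle_def)
next
  case False
  have adj: "card (t (Suc i mod n) \<inter> t (Suc j mod n)) = 2"
    if "i < j" "j < n" "j = Suc i \<or> i = 0 \<and> Suc j = n" for i j
  proof (cases "Suc j = n")
    case True
    with that triangle_cycle_adj[OF assms, of 0 "Suc i"] show ?thesis by (auto simp: Int_commute)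
  next
    case False
    with that triangle_cycle_adj[OF assms, of "Suc i" "Suc j"] show ?thesis by auto
  qed
  have nonadj: "card (t (Suc i mod n) \<inter> t (Suc j mod n)) \<le> 1"
    if "i < j" "j < n" "\<not> (j = Suc i \<or> i = 0 \<and> Suc j = n)" for i j
  proof (cases "Suc j = n")
    case True
    with that triangle_cycle_nonadj[OF assms, of 0 "Suc i"] show ?thesis by (auto simp: Int_commute)
  next
    case False
    with that triangle_cycle_nonadj[OF assms, of "Suc i" "Suc j"] show ?thesis by auto
  qed
  show ?thesis
    by (rule triangle_cycleI) (use False triangle_cycle_card[OF assms] adj nonadj in auto)
qed

lemma Suc_mod_image: "(\<lambda>i. Suc i mod n) ` {..<n} = {..<n}"
proof (cases "n = 0")
  case False
  show ?thesis
  proof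
    show "{..<n} \<subseteq> (\<lambda>i. Suc i mod n) ` {..<n}"
    proof
      fix j assume "j \<in> {..<n}"
      then show "j \<in> (\<lambda>i. Suc i mod n) ` {..<n}"
        using False by (cases j) (auto intro: image_eqI[of _ _ "n - 1"] image_eqI[of _ _ "j - 1"])
    qed
  qed (use False in auto)
qed simp

lemma triangle_cycle_rotate:
  assumes "triangle_cycle n t"
  shows "triangle_cycle n (\<lambda>i. t ((i + k) mod n))" "(\<lambda>i. t ((i + k) mod n)) ` {..<n} = t ` {..<n}"
proof (induction k)
  case 0
  { case 1
    show ?case using assms by (rule triangle_cycle_cong) simp
  next
    case 2 show ?case by (auto intro!: image_cong) }
next
  case (Suc k)
  have eq: "(\<lambda>i. t ((i + Suc k) mod n)) = (\<lambda>i. (\<lambda>i. t ((i + k) mod n)) (Suc i mod n))"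
    by (simp add: mod_simps)
  { case 1
    show ?case unfolding eq using triangle_cycle_rotate1[OF Suc.IH(1)] .
  next
    case 2
    show ?case unfolding eq Suc.IH(2)[symmetric] by (subst (2) Suc_mod_image[symmetric]) (simp only: image_image) }
qed

text \<open>
  Lets an operation on an arbitrary triangle of the cycle assume that it is the last one.
\<close>

lemma triangle_cycle_rotate_to:
  assumes "triangle_cycle n t" "k < n"
  shows "\<exists>t'. triangle_cycle n t' \<and> t' ` {..<n} = t ` {..<n} \<and> t' (n - 1) = t k"
proof -
  have "n - 1 + Suc k = k + n" using assms(2) by simp
  then have "(n - 1 + Suc k) mod n = k" using assms(2) by simp
  then show ?thesis using triangle_cycle_rotate[OF assms(1), of "Suc k"] by metis
qed

section \<open>Induced cycles of the triangle graph\<close>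

lemma simple_edge: "simple_graph G \<Longrightarrow> e \<in> edges G \<Longrightarrow> \<exists>a b. e = {a, b} \<and> a \<noteq> b \<and> a \<in> verts G \<and> b \<in> verts G"
  unfolding simple_graph_def by (metis card_2_iff insert_subset)

lemma triangle_finite: "t \<in> triangles G \<Longrightarrow> finite t"
  unfolding triangles_def using card.infinite by fastforce

lemma triangle_edge: "t \<in> triangles G \<Longrightarrow> {a, b} \<subseteq> t \<Longrightarrow> a \<noteq> b \<Longrightarrow> {a, b} \<in> edges G"
  unfolding triangles_def by auto

text \<open>
  The shared edge is not an extra condition: two common vertices of two triangles are adjacent anyway.
\<close>

lemma triangle_graph_edge:
  assumes "simple_graph G"
  shows "{s, t} \<in> edges (triangle_graph G) \<longleftrightarrow> s \<in> triangles G \<and> t \<in> triangles G \<and> card (s \<inter> t) = 2"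
proof
  assume "{s, t} \<in> edges (triangle_graph G)"
  then obtain e where e: "s \<in> triangles G" "t \<in> triangles G" "s \<noteq> t" "e \<in> edges G" "e \<subseteq> s \<inter> t"
    unfolding triangle_graph_def by (auto simp: doubleton_eq_iff)
  have c: "card s = 3" "card t = 3" using e(1,2) by (auto simp: triangles_def)
  have f: "finite s" "finite t" using e(1,2) triangle_finite by auto
  have "card e = 2" using assms e(4) by (auto simp: simple_graph_def)
  then have "2 \<le> card (s \<inter> t)" using e(5) f by (metis card_mono finite_Int)
  moreover have "card (s \<inter> t) \<noteq> 3"
    using c f e(3) by (metis card_subset_eq inf_le1 inf_le2)
  moreover have "card (s \<inter> t) \<le> 3" using c(1) f by (metis card_mono inf_le1)
  ultimately show "s \<in> triangles G \<and> t \<in> triangles G \<and> card (s \<inter> t) = 2" using e by linarith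
next
  assume *: "s \<in> triangles G \<and> t \<in> triangles G \<and> card (s \<inter> t) = 2"
  then obtain a b where ab: "s \<inter> t = {a, b}" "a \<noteq> b" by (auto simp: card_2_iff)
  then have "{a, b} \<in> edges G" using * triangle_edge[of s G a b] by blast
  moreover have "s \<noteq> t" using * by (auto simp: triangles_def)
  ultimately show "{s, t} \<in> edges (triangle_graph G)"
    using * ab(1) unfolding triangle_graph_def graph.sel by blast
qed

lemma cycle_graph_edge:
  assumes "3 \<le> n" "i < j" "j < n"
  shows "{i, j} \<in> edges (cycle_graph n) \<longleftrightarrow> j = Suc i \<or> i = 0 \<and> Suc j = n"
proof
  assume "{i, j} \<in> edges (cycle_graph n)"
  then obtain k where k: "{i, j} = {k, Suc k mod n}" "k < n" unfolding cycle_graph_def by auto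
  then show "j = Suc i \<or> i = 0 \<and> Suc j = n"
    using assms by (cases "Suc k = n") (auto simp: doubleton_eq_iff)
next
  assume *: "j = Suc i \<or> i = 0 \<and> Suc j = n"
  then have "{i, j} = {i, Suc i mod n} \<or> {i, j} = {j, Suc j mod n}"
  proof
    assume "j = Suc i" then have "Suc i mod n = j" using assms(3) by simp
    then show ?thesis by simp
  next
    assume "i = 0 \<and> Suc j = n" then have "Suc j mod n = i" by simp
    then show ?thesis by (simp add: insert_commute)
  qed
  then show "{i, j} \<in> edges (cycle_graph n)"
    using assms less_trans[OF assms(2,3)] unfolding cycle_graph_def graph.sel by blast
qed

lemma simple_cycle_graph: "3 \<le> n \<Longrightarrow> simple_graph (cycle_graph n)"
  unfolding simple_graph_def cycle_graph_def by (auto simp: card_insert_if mod_Suc)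

lemma cycle_graph_edge_triangle_cycle:
  assumes "3 \<le> n" "triangle_cycle n t" "i < n" "j < n"
  shows "{i, j} \<in> edges (cycle_graph n) \<longleftrightarrow> card (t i \<inter> t j) = 2"
proof -
  have *: "{i, j} \<in> edges (cycle_graph n) \<longleftrightarrow> card (t i \<inter> t j) = 2" if "i < j" "j < n" for i j
    unfolding cycle_graph_edge[OF assms(1) that]
    using triangle_cycle_adj[OF assms(2) that] triangle_cycle_nonadj[OF assms(2) that] by fastforce
  show ?thesis
  proof (cases i j rule: linorder_cases)
    case equal
    have "{i} \<notin> edges (cycle_graph n)" using simple_cycle_graph[OF assms(1)] by (force simp: simple_graph_def)
    then show ?thesis using equal triangle_cycle_card[OF assms(2,3)] by simp
  next
    case greater
    then show ?thesis using *[of j i] assms by (simp add: Int_commute insert_commute)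
  qed (use * assms in auto)
qed

lemma induced_cycle_iff:
  assumes "simple_graph G"
  shows "induced_cycle (triangle_graph G) n S \<longleftrightarrow>
    3 \<le> n \<and> (\<exists>t. triangle_cycle n t \<and> t ` {..<n} = S \<and> S \<subseteq> triangles G)"
proof -
  have e: "{x, y} \<in> edges (induced_subgraph (triangle_graph G) S) \<longleftrightarrow> card (x \<inter> y) = 2"
    if "x \<in> S" "y \<in> S" "S \<subseteq> triangles G" for x y
    using that triangle_graph_edge[OF assms, of x y] unfolding induced_subgraph_def by auto
  have v: "verts (triangle_graph G) = triangles G" "verts (induced_subgraph (triangle_graph G) S) = S"
    "verts (cycle_graph n) = {..<n}"
    by (auto simp: triangle_graph_def induced_subgraph_def cycle_graph_def)
  show ?thesis
  proof
    assume *: "induced_cycle (triangle_graph G) n S"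
    then have n: "3 \<le> n" and S: "S \<subseteq> triangles G" by (auto simp: induced_cycle_def v)
    obtain f where f: "bij_betw f S {..<n}"
      "\<And>x y. x \<in> S \<Longrightarrow> y \<in> S \<Longrightarrow> {x, y} \<in> edges (induced_subgraph (triangle_graph G) S) \<longleftrightarrow> {f x, f y} \<in> edges (cycle_graph n)"
      using * unfolding induced_cycle_def isomorphic_def v by blast
    define t where "t = inv_into S f"
    have t: "bij_betw t {..<n} S" unfolding t_def using bij_betw_inv_into f(1) by blast
    have tS: "t i \<in> S" and ft: "f (t i) = i" if "i < n" for i
      using that f(1) t by (auto simp: t_def bij_betw_inv_into_right bij_betwE)
    have card3: "card (t i) = 3" if "i < n" for i using tS[OF that] S by (auto simp: triangles_def)
    have iff: "card (t i \<inter> t j) = 2 \<longleftrightarrow> j = Suc i \<or> i = 0 \<and> Suc j = n" if "i < j" "j < n" for i j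
    proof -
      have "i < n" using that by simp
      then show ?thesis using cycle_graph_edge[OF n that] e[OF _ _ S] f(2) tS ft that(2) by metis
    qed
    have "triangle_cycle n t"
    proof (rule triangle_cycleI)
      fix i j assume ij: "i < j" "j < n" "\<not> (j = Suc i \<or> i = 0 \<and> Suc j = n)"
      have fin: "finite (t i)" "finite (t j)" using ij card3 by (metis card.infinite less_trans zero_neq_numeral)+
      have "t i \<noteq> t j" using ft ij by (metis less_trans nat_neq_iff)
      then have "card (t i \<inter> t j) \<noteq> 3"
        using card3[of i] card3[of j] ij fin by (metis card_subset_eq inf_le1 inf_le2 less_trans)
      moreover have "card (t i \<inter> t j) \<le> 3" using card3[of i] fin ij by (metis card_mono inf_le1 less_trans)
      moreover have "card (t i \<inter> t j) \<noteq> 2" using iff[OF ij(1,2)] ij(3) by simp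
      ultimately show "card (t i \<inter> t j) \<le> 1" by linarith
    qed (use card3 iff in auto)
    then show "3 \<le> n \<and> (\<exists>t. triangle_cycle n t \<and> t ` {..<n} = S \<and> S \<subseteq> triangles G)"
      using n S t by (auto simp: bij_betw_def)
  next
    assume "3 \<le> n \<and> (\<exists>t. triangle_cycle n t \<and> t ` {..<n} = S \<and> S \<subseteq> triangles G)"
    then obtain t where n: "3 \<le> n" and t: "triangle_cycle n t" "t ` {..<n} = S" "S \<subseteq> triangles G" by blast
    have b: "bij_betw t {..<n} S" using triangle_cycle_inj[OF t(1)] t(2) by (simp add: bij_betw_def)
    define f where "f = inv_into {..<n} t"
    have f: "bij_betw f S {..<n}" unfolding f_def using bij_betw_inv_into[OF b] .
    have "{x, y} \<in> edges (induced_subgraph (triangle_graph G) S) \<longleftrightarrow> {f x, f y} \<in> edges (cycle_graph n)"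
      if "x \<in> S" "y \<in> S" for x y
    proof -
      have "f x < n" "f y < n" using f that by (auto dest: bij_betwE)
      moreover have "t (f x) = x" "t (f y) = y" using that b by (auto simp: f_def bij_betw_inv_into_right)
      ultimately show ?thesis using cycle_graph_edge_triangle_cycle[OF n t(1), of "f x" "f y"] e[OF that t(3)] by simp
    qed
    then show "induced_cycle (triangle_graph G) n S"
      unfolding induced_cycle_def isomorphic_def v using n t(3) f by blast
  qed
qed

lemma triangle_image:
  assumes "inj_on g (verts H)" "g ` verts H \<subseteq> verts G" "\<And>e. e \<in> edges H \<Longrightarrow> g ` e \<in> edges G"
    "t \<in> triangles H"
  shows "g ` t \<in> triangles G"
proof -
  have t: "t \<subseteq> verts H" "card t = 3" "\<And>x y. x \<in> t \<Longrightarrow> y \<in> t \<Longrightarrow> x \<noteq> y \<Longrightarrow> {x, y} \<in> edges H"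
    using assms(4) unfolding triangles_def by auto
  have "card (g ` t) = 3" using t(1,2) assms(1) by (metis card_image inj_on_subset)
  moreover have "{g x, g y} \<in> edges G" if "x \<in> t" "y \<in> t" "g x \<noteq> g y" for x y
    using assms(3)[OF t(3)[of x y]] that by auto
  moreover have "g ` t \<subseteq> verts G" using t(1) assms(2) by blast
  ultimately show ?thesis unfolding triangles_def by auto
qed

lemma triangle_cycle_image:
  assumes "triangle_cycle n t" "inj_on g A" "\<And>i. i < n \<Longrightarrow> t i \<subseteq> A"
  shows "triangle_cycle n (\<lambda>i. g ` t i)"
proof -
  have c: "card (g ` B) = card B" if "B \<subseteq> A" for B using that assms(2) by (metis card_image inj_on_subset)
  have i: "card (g ` t i \<inter> g ` t j) = card (t i \<inter> t j)" if "i < j" "j < n" for i j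
  proof -
    have "t i \<subseteq> A" "t j \<subseteq> A" using assms(3) that by auto
    moreover from this have "t i \<inter> t j \<subseteq> A" by blast
    ultimately show ?thesis using inj_on_image_Int[OF assms(2)] c by metis
  qed
  show ?thesis
  proof (rule triangle_cycleI)
    fix i assume "i < n" then show "card (g ` t i) = 3" using c assms(3) triangle_cycle_card[OF assms(1)] by simp
  next
    fix i j assume ij: "i < j" "j < n"
    show "card (g ` t i \<inter> g ` t j) = 2" if "j = Suc i \<or> i = 0 \<and> Suc j = n"
      unfolding i[OF ij] using triangle_cycle_adj[OF assms(1) ij that] .
    show "card (g ` t i \<inter> g ` t j) \<le> 1" if "\<not> (j = Suc i \<or> i = 0 \<and> Suc j = n)"
      unfolding i[OF ij] using triangle_cycle_nonadj[OF assms(1) ij that] .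
  qed
qed

text \<open>
  The copy of \<open>H\<close> inside \<open>G\<close> is the image of an injective homomorphism, and maps are easier to build
  than subgraphs.
\<close>

lemma has_subgraph_iff_embedding:
  assumes "simple_graph H"
  shows "has_subgraph_isomorphic_to G H \<longleftrightarrow>
    (\<exists>g. inj_on g (verts H) \<and> g ` verts H \<subseteq> verts G \<and> (\<forall>e\<in>edges H. g ` e \<in> edges G))"
proof
  assume "has_subgraph_isomorphic_to G H"
  then obtain K f where K: "subgraph K G" and f: "bij_betw f (verts K) (verts H)"
    "\<And>x y. x \<in> verts K \<Longrightarrow> y \<in> verts K \<Longrightarrow> {x, y} \<in> edges K \<longleftrightarrow> {f x, f y} \<in> edges H"
    unfolding has_subgraph_isomorphic_to_def isomorphic_def by blast
  define g where "g = inv_into (verts K) f"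
  have g: "bij_betw g (verts H) (verts K)" unfolding g_def using bij_betw_inv_into[OF f(1)] .
  have gK: "g a \<in> verts K" "f (g a) = a" if "a \<in> verts H" for a
    using that f(1) g by (auto simp: g_def bij_betw_inv_into_right bij_betwE)
  have "g ` e \<in> edges G" if "e \<in> edges H" for e
  proof -
    obtain a b where ab: "e = {a, b}" "a \<in> verts H" "b \<in> verts H" using simple_edge[OF assms \<open>e \<in> edges H\<close>] by blast
    then have "{g a, g b} \<in> edges K" using f(2) gK that by auto
    then show ?thesis using ab(1) K by (auto simp: subgraph_def)
  qed
  then show "\<exists>g. inj_on g (verts H) \<and> g ` verts H \<subseteq> verts G \<and> (\<forall>e\<in>edges H. g ` e \<in> edges G)"
    using g K by (auto simp: bij_betw_def subgraph_def)
next
  assume "\<exists>g. inj_on g (verts H) \<and> g ` verts H \<subseteq> verts G \<and> (\<forall>e\<in>edges H. g ` e \<in> edges G)"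
  then obtain g where g: "inj_on g (verts H)" "g ` verts H \<subseteq> verts G" "\<And>e. e \<in> edges H \<Longrightarrow> g ` e \<in> edges G" by blast
  define K where "K = Graph (g ` verts H) ((`) g ` edges H)"
  have ver: "verts K = g ` verts H" "edges K = (`) g ` edges H" by (auto simp: K_def)
  have sub: "e \<subseteq> verts H" "card e = 2" if "e \<in> edges H" for e using that assms by (auto simp: simple_graph_def)
  have "subgraph K G"
    unfolding subgraph_def simple_graph_def ver
  proof (intro conjI ballI)
    fix e assume "e \<in> (`) g ` edges H"
    then obtain e' where e': "e' \<in> edges H" "e = g ` e'" by blast
    show "e \<subseteq> g ` verts H" "card e = 2"
      using sub[OF e'(1)] g(1) e'(2) by (auto simp: card_image inj_on_subset)
  qed (use g assms in \<open>auto simp: simple_graph_def\<close>)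
  moreover have "isomorphic K H"
    unfolding isomorphic_def ver
  proof (intro exI conjI ballI)
    show "bij_betw (inv_into (verts H) g) (g ` verts H) (verts H)"
      by (simp add: bij_betw_inv_into g(1) inj_on_imp_bij_betw)
    fix x y assume "x \<in> g ` verts H" "y \<in> g ` verts H"
    then obtain a b where ab: "a \<in> verts H" "b \<in> verts H" "x = g a" "y = g b" by blast
    have "{x, y} \<in> (`) g ` edges H \<longleftrightarrow> {a, b} \<in> edges H"
    proof
      assume "{x, y} \<in> (`) g ` edges H"
      then obtain e where e: "e \<in> edges H" "g ` {a, b} = g ` e" using ab by auto
      then have "{a, b} = e" using inj_on_image_eq_iff[OF g(1), of "{a, b}" e] ab sub(1) by blast
      then show "{a, b} \<in> edges H" using e by simp
    next
      assume "{a, b} \<in> edges H" then have "g ` {a, b} \<in> (`) g ` edges H" by (rule imageI)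
      then show "{x, y} \<in> (`) g ` edges H" using ab by simp
    qed
    then show "{x, y} \<in> (`) g ` edges H \<longleftrightarrow> {inv_into (verts H) g x, inv_into (verts H) g y} \<in> edges H"
      using ab g(1) by simp
  qed
  ultimately show "has_subgraph_isomorphic_to G H" unfolding has_subgraph_isomorphic_to_def by blast
qed

text \<open>
  Passing to a supergraph can create triangles but cannot change how many vertices two given triangles
  share, so the cycle stays induced.
\<close>

lemma induced_cycle_supergraph:
  assumes "simple_graph G" "simple_graph H" "has_subgraph_isomorphic_to G H"
    "induced_cycle (triangle_graph H) n S"
  shows "\<exists>S'. induced_cycle (triangle_graph G) n S'"
proof -
  obtain g where g: "inj_on g (verts H)" "g ` verts H \<subseteq> verts G" "\<And>e. e \<in> edges H \<Longrightarrow> g ` e \<in> edges G"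
    using assms(3) unfolding has_subgraph_iff_embedding[OF assms(2)] by blast
  obtain t where n: "3 \<le> n" and t: "triangle_cycle n t" "t ` {..<n} = S" "S \<subseteq> triangles H"
    using assms(4) unfolding induced_cycle_iff[OF assms(2)] by blast
  have ti: "t i \<in> triangles H" if "i < n" for i using t(2,3) that by auto
  then have "t i \<subseteq> verts H" if "i < n" for i using that unfolding triangles_def by blast
  then have "triangle_cycle n (\<lambda>i. g ` t i)" using triangle_cycle_image[OF t(1) g(1)] by blast
  moreover have "g ` t i \<in> triangles G" if "i < n" for i using triangle_image[OF g ti[OF that]] .
  ultimately show ?thesis unfolding induced_cycle_iff[OF assms(1)] using n by blast
qed

lemma specified_cycleI:
  assumes "simple_graph H" "induced_cycle (triangle_graph H) n S" "4 \<le> n"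
  shows "specified_cycle H S"
proof -
  obtain t where t: "triangle_cycle n t" "t ` {..<n} = S"
    using assms(2) unfolding induced_cycle_iff[OF assms(1)] by blast
  then have "card S = n" using card_image[OF triangle_cycle_inj] by fastforce
  then show ?thesis using assms unfolding specified_cycle_def by auto
qed

section \<open>Weak edge splitting\<close>

definition split_graph :: "'a graph \<Rightarrow> 'a \<Rightarrow> 'a \<Rightarrow> 'a \<Rightarrow> 'a \<Rightarrow> 'a graph" where
  "split_graph H u v x w = Graph (insert w (verts H)) (edges H - {{u, v}} \<union> {{u, w}, {w, v}, {w, x}})"

text \<open>
  The triangle \<open>{u, v, x}\<close> is replaced by \<open>{v, w, x}\<close> and \<open>{u, w, x}\<close>. As \<open>{u, v}\<close> is private, the two
  neighbours of \<open>{u, v, x}\<close> meet it in \<open>{u, x}\<close> and \<open>{v, x}\<close>. They cannot both use the same one of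
  these edges, since for \<open>n \<ge> 4\<close> they are not adjacent to each other. Hence the successor \<open>t 0\<close>, which
  is assumed to use \<open>{u, x}\<close>, follows \<open>{u, w, x}\<close>, and the predecessor precedes \<open>{v, w, x}\<close>.
\<close>

lemma triangle_cycle_split:
  assumes t: "triangle_cycle n t" and n: "4 \<le> n" and last: "t (n - 1) = {u, v, x}"
    and priv: "\<And>i. i < n - 1 \<Longrightarrow> \<not> {u, v} \<subseteq> t i" and out: "{u, x} \<subseteq> t 0"
    and fresh: "\<And>i. i < n \<Longrightarrow> w \<notin> t i"
  shows "triangle_cycle (Suc n) (t(n - 1 := {v, w, x}, n := {u, w, x}))"
proof -
  let ?t = "t(n - 1 := {v, w, x}, n := {u, w, x})"
  have c3: "card {u, v, x} = 3" using triangle_cycle_card[OF t, of "n - 1"] last n by simp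
  then have d: "u \<noteq> v" "u \<noteq> x" "v \<noteq> x" by (auto simp: card_insert_if split: if_splits)
  have w: "w \<noteq> u" "w \<noteq> v" "w \<noteq> x" using fresh[of "n - 1"] last n by auto
  have ux: "\<not> {u, x} \<subseteq> t i" if "0 < i" "i < n - 1" for i
  proof
    assume "{u, x} \<subseteq> t i"
    then have "i = Suc 0"
      using triangle_cycle_sharing[OF t, of 0 i u x] out that n d \<open>{u, x} \<subseteq> t i\<close> by force
    moreover from \<open>{u, x} \<subseteq> t i\<close> have "n - 1 = Suc i \<or> i = 0"
      using triangle_cycle_sharing[OF t, of i "n - 1" u x] last that n d by auto
    ultimately show False using n by simp
  qed
  have vx: "\<not> {v, x} \<subseteq> t i" if "i < n - 2" for i
  proof
    assume vx: "{v, x} \<subseteq> t i"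
    then have "n - 1 = Suc i \<or> i = 0" using triangle_cycle_sharing[OF t, of i "n - 1" v x] last that n d by auto
    then have "i = 0" using that by linarith
    then show False using priv[of 0] vx out that by auto
  qed
  have "{v, x} \<subseteq> t (n - 2)"
  proof -
    have "card (t (n - 2) \<inter> {u, v, x}) = 2"
    proof -
      have "n - 1 = Suc (n - 2)" using n by simp
      then show ?thesis using triangle_cycle_adj[OF t, of "n - 2" "n - 1"] n unfolding last by linarith
    qed
    moreover have "t (n - 2) \<inter> {u, v, x} \<subseteq> {y \<in> {u, v, x}. y \<in> t (n - 2)}" by auto
    moreover have "\<not> {u, v} \<subseteq> t (n - 2)" "\<not> {u, x} \<subseteq> t (n - 2)"
      using priv[of "n - 2"] ux[of "n - 2"] n by auto
    ultimately show ?thesis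
      by (cases "u \<in> t (n - 2)"; cases "v \<in> t (n - 2)"; cases "x \<in> t (n - 2)") (auto simp: Int_insert_right)
  qed
  then have vx2: "v \<in> t (n - 2)" "x \<in> t (n - 2)" "u \<notin> t (n - 2)" using ux[of "n - 2"] n by auto
  have ux0: "u \<in> t 0" "x \<in> t 0" "v \<notin> t 0" using out priv[of 0] n by auto
  have old: "?t i = t i" if "i < n - 1" for i using that by auto
  have new: "?t (n - 1) = {v, w, x}" "?t n = {u, w, x}" using n by auto
  show ?thesis
  proof (rule triangle_cycleI)
    fix i assume "i < Suc n"
    then show "card (?t i) = 3"
      using triangle_cycle_card[OF t, of i] d w n by (auto simp: card_insert_if)
  next
    fix i j assume ij: "i < j" "j < Suc n"
    show "card (?t i \<inter> ?t j) = 2" if adj: "j = Suc i \<or> i = 0 \<and> Suc j = Suc n"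
    proof -
      consider "j < n - 1" | "j = n - 1" | "j = n" "i = n - 1" | "j = n" "i = 0" using ij adj by fastforce
      then show ?thesis
      proof cases
        case 1
        then show ?thesis using triangle_cycle_adj[OF t ij(1)] adj old ij by auto
      next
        case 2
        then have i: "i = n - 2" using adj n by linarith
        have "?t i \<inter> ?t j = t (n - 2) \<inter> {v, w, x}" unfolding 2 new(1) i using old[of "n - 2"] n by simp
        also have "\<dots> = {v, x}" using vx2 fresh[of "n - 2"] n by auto
        finally show ?thesis using d by simp
      next
        case 3
        then have "?t i \<inter> ?t j = {w, x}" using new d w by auto
        then show ?thesis using w by simp
      next
        case 4
        then have "?t i \<inter> ?t j = {u, x}" using new old[of 0] ux0 fresh[of 0] n by auto
        then show ?thesis using d by simp
      qed
    qed
    show "card (?t i \<inter> ?t j) \<le> 1" if nadj: "\<not> (j = Suc i \<or> i = 0 \<and> Suc j = Suc n)"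
    proof -
      consider "j < n - 1" | "j = n - 1" "i < n - 2" | "j = n" "0 < i" "i < n - 1" using ij nadj by fastforce
      then show ?thesis
      proof cases
        case 1
        then have "j < n" "\<not> (j = Suc i \<or> i = 0 \<and> Suc j = n)" "?t i = t i" "?t j = t j"
          using nadj old ij by auto
        then show ?thesis using triangle_cycle_nonadj[OF t ij(1)] by metis
      next
        case 2
        then have "i < n - 1" "i < n" by auto
        then have "?t i \<inter> ?t j = t i \<inter> {v, x}"
          unfolding 2(1) new old[OF \<open>i < n - 1\<close>] using fresh[of i] by auto
        then show ?thesis using vx[OF 2(2)] by (intro card_le_1I) auto
      next
        case 3
        then have "i < n - 1" "i < n" by auto
        then have "?t i \<inter> ?t j = t i \<inter> {u, x}"
          unfolding 3(1) new old[OF \<open>i < n - 1\<close>] using fresh[of i] by auto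
        then show ?thesis using ux[OF 3(2,3)] by (intro card_le_1I) auto
      qed
    qed
  qed
qed

lemma simple_split_graph:
  assumes "simple_graph H" "{u, v, x} \<in> triangles H" "w \<notin> verts H"
  shows "simple_graph (split_graph H u v x w)"
proof -
  have "u \<in> verts H" "v \<in> verts H" "x \<in> verts H" using assms(2) by (auto simp: triangles_def)
  then show ?thesis using assms(1,3) unfolding simple_graph_def split_graph_def by (auto simp: card_insert_if)
qed

lemma triangles_split_graph:
  assumes "{u, v, x} \<in> triangles H" "w \<notin> verts H"
  shows "{v, w, x} \<in> triangles (split_graph H u v x w)" "{u, w, x} \<in> triangles (split_graph H u v x w)"
    and "t \<in> triangles H \<Longrightarrow> \<not> {u, v} \<subseteq> t \<Longrightarrow> t \<in> triangles (split_graph H u v x w)"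
proof -
  have c: "card {u, v, x} = 3" and in_v: "u \<in> verts H" "v \<in> verts H" "x \<in> verts H"
    using assms(1) by (auto simp: triangles_def)
  from c have d: "u \<noteq> v" "u \<noteq> x" "v \<noteq> x" by (auto simp: card_insert_if split: if_splits)
  have e: "{u, x} \<in> edges H" "{v, x} \<in> edges H"
    using triangle_edge[OF assms(1)] d by auto
  have w: "w \<noteq> u" "w \<noteq> v" "w \<noteq> x" using assms(2) in_v by auto
  show "{v, w, x} \<in> triangles (split_graph H u v x w)" "{u, w, x} \<in> triangles (split_graph H u v x w)"
    using d e w in_v unfolding triangles_def split_graph_def
    by (auto simp: insert_commute doubleton_eq_iff card_insert_if)
  show "t \<in> triangles (split_graph H u v x w)" if "t \<in> triangles H" "\<not> {u, v} \<subseteq> t"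
    using that unfolding triangles_def split_graph_def by (auto simp: doubleton_eq_iff)
qed

lemma triangle_cycle_image_butlast:
  assumes "triangle_cycle n t" "0 < n"
  shows "t ` {..<n} - {t (n - 1)} = t ` {..<n - 1}"
proof -
  have "{..<n} = insert (n - 1) {..<n - 1}" using assms(2) by auto
  moreover have "t (n - 1) \<notin> t ` {..<n - 1}"
  proof
    assume "t (n - 1) \<in> t ` {..<n - 1}"
    then obtain i where i: "i < n - 1" "t (n - 1) = t i" by blast
    have "n - 1 = i" by (rule inj_onD[OF triangle_cycle_inj[OF assms(1)] i(2)]) (use i(1) assms(2) in auto)
    then show False using i(1) by simp
  qed
  ultimately show ?thesis by simp
qed

lemma split_images:
  assumes "triangle_cycle n t" "t (n - 1) = {u, v, x}" "0 < n"
  shows "(t(n - 1 := {v, w, x}, n := {u, w, x})) ` {..<Suc n} = t ` {..<n} - {{u, v, x}} \<union> {{u, w, x}, {w, v, x}}"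
proof -
  let ?t = "t(n - 1 := {v, w, x}, n := {u, w, x})"
  have "{..<Suc n} = insert n (insert (n - 1) {..<n - 1})" using assms(3) by auto
  then have "?t ` {..<Suc n} = insert (?t n) (insert (?t (n - 1)) (?t ` {..<n - 1}))"
    by (simp only: image_insert)
  moreover have "?t n = {u, w, x}" "?t (n - 1) = {w, v, x}" using assms(3) by auto
  moreover have "?t ` {..<n - 1} = t ` {..<n - 1}" by (rule image_cong) auto
  moreover have "t ` {..<n} - {{u, v, x}} = t ` {..<n - 1}"
    using triangle_cycle_image_butlast[OF assms(1,3)] assms(2) by simp
  ultimately show ?thesis by (simp only: Un_insert_right Un_empty_right)
qed

lemma weak_edge_splitting_induced_cycle:
  assumes "weak_edge_splitting (H, S) (H', S')" "induced_cycle (triangle_graph H) n S" "4 \<le> n"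
  shows "simple_graph H' \<and> induced_cycle (triangle_graph H') (Suc n) S'"
  using assms(1)
proof cases
  case (1 u v x w)
  note H' = 1(1) and S' = 1(2) and simple = 1(3)
  obtain t0 where t0: "triangle_cycle n t0" "t0 ` {..<n} = S" and S: "S \<subseteq> triangles H"
    using assms(2) unfolding induced_cycle_iff[OF simple] by blast
  obtain k where "k < n" "t0 k = {u, v, x}" using t0(2) \<open>{u, v, x} \<in> S\<close> by auto
  then obtain t where t: "triangle_cycle n t" "t ` {..<n} = S" "t (n - 1) = {u, v, x}"
    using triangle_cycle_rotate_to[OF t0(1)] t0(2) by metis
  have tri: "{u, v, x} \<in> triangles H" using S 1(5) by auto
  have w: "w \<notin> t i" if "i < n" for i using that t(2) S 1(8) unfolding triangles_def by blast
  have other: "t i \<in> S" "t i \<noteq> {u, v, x}" if "i < n - 1" for i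
    using that triangle_cycle_image_butlast[OF t(1)] t(2,3) assms(3) by auto
  have private_e: "\<not> {u, v} \<subseteq> t i" if "i < n - 1" for i
    using 1(5,7) other[OF that] unfolding private_edge_def by blast
  have n3: "3 \<le> Suc n" using assms(3) by simp
  have priv: "\<not> {u, v} \<subseteq> s" if "s \<in> S" "s \<noteq> {u, v, x}" for s
    using 1(5,7) that unfolding private_edge_def by blast
  \<comment> \<open>by symmetry in the ends of the private edge, the end on the side of t 0 may be called a\<close>
  have goal: "simple_graph H' \<and> induced_cycle (triangle_graph H') (Suc n) S'"
    if ux: "{a, x} \<subseteq> t 0" and ab: "a = u \<and> b = v \<or> a = v \<and> b = u" for a b
  proof -
    have sg: "H' = split_graph H a b x w" using ab H' unfolding split_graph_def by (auto simp: insert_commute)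
    have abx: "{a, b, x} = {u, v, x}" "{a, b} = {u, v}" "{{a, w, x}, {w, b, x}} = {{u, w, x}, {w, v, x}}"
      using ab by (auto simp: insert_commute)
    have tri': "{a, b, x} \<in> triangles H" using tri abx by simp
    let ?t = "t(n - 1 := {b, w, x}, n := {a, w, x})"
    have "triangle_cycle (Suc n) ?t"
      using triangle_cycle_split[OF t(1) assms(3), of a b x w] t(3) abx private_e ux w by simp
    moreover have "?t ` {..<Suc n} = S'"
      using split_images[OF t(1), of a b x w] assms(3) unfolding S' abx t(2,3) by simp
    moreover have "S' \<subseteq> triangles H'"
    proof
      fix s assume "s \<in> S'"
      then consider "s \<in> S" "s \<noteq> {u, v, x}" | "s = {b, w, x}" | "s = {a, w, x}"
        using ab unfolding S' by (auto simp: insert_commute)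
      then show "s \<in> triangles H'"
        using triangles_split_graph[OF tri' 1(8)] S priv[of s] abx(2) unfolding sg by cases auto
    qed
    moreover have "simple_graph H'" unfolding sg using simple_split_graph[OF simple tri' 1(8)] .
    ultimately show ?thesis unfolding induced_cycle_iff[OF \<open>simple_graph H'\<close>] using n3 by blast
  qed
  have "card (t 0 \<inter> {u, v, x}) = 2" using triangle_cycle_adj[OF t(1), of 0 "n - 1"] t(3) assms(3) by simp
  moreover have "\<not> {u, v} \<subseteq> t 0" using private_e assms(3) by simp
  ultimately have "{u, x} \<subseteq> t 0 \<or> {v, x} \<subseteq> t 0"
    by (cases "u \<in> t 0"; cases "v \<in> t 0"; cases "x \<in> t 0") (auto simp: Int_insert_right)
  then show ?thesis using goal[of u v] goal[of v u] by blast
qed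

lemma splittings_induced_cycle:
  assumes "(H, S) \<in> splittings H0 m k" "simple_graph H0" "4 \<le> m"
  shows "simple_graph H \<and> induced_cycle (triangle_graph H) (m + k) S"
proof -
  obtain S0 where S0: "induced_cycle (triangle_graph H0) m S0" and r: "(weak_edge_splitting ^^ k) (H0, S0) (H, S)"
    using assms(1) unfolding splittings_def by blast
  have "simple_graph (fst Q) \<and> induced_cycle (triangle_graph (fst Q)) (m + k) (snd Q)"
    if "(weak_edge_splitting ^^ k) (H0, S0) Q" for Q
    using that
  proof (induction k arbitrary: Q)
    case 0 then show ?case using S0 assms by auto
  next
    case (Suc k)
    then obtain P where P: "(weak_edge_splitting ^^ k) (H0, S0) P" "weak_edge_splitting P Q" by auto
    then show ?case
      using Suc.IH[OF P(1)] weak_edge_splitting_induced_cycle[of "fst P" "snd P" "fst Q" "snd Q" "m + k"] assms(3)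
      by simp
  qed
  from this[OF r] show ?thesis by simp
qed

section \<open>Short distances\<close>

text \<open>
  Only walks with at most two edges have to be excluded, and these are spelled out on the right.
\<close>

lemma gdist_ge_3_iff:
  assumes "simple_graph G" "a \<in> verts G" "b \<in> verts G"
  shows "3 \<le> gdist G a b \<longleftrightarrow> a \<noteq> b \<and> {a, b} \<notin> edges G \<and> (\<nexists>y. {a, y} \<in> edges G \<and> {y, b} \<in> edges G)"
proof -
  have ev: "y \<in> verts G" if "{y, z} \<in> edges G" for y z using that assms(1) by (auto simp: simple_graph_def)
  have le: "gdist G a b \<le> enat (length p - 1)" if "walk G p" "hd p = a" "last p = b" for p
    unfolding gdist_def using that by (intro INF_lower) auto
  have short: "\<not> 3 \<le> gdist G a b" if "walk G p" "hd p = a" "last p = b" "length p \<le> 3" for p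
  proof
    assume "3 \<le> gdist G a b"
    then have "3 \<le> enat (length p - 1)" using le[OF that(1-3)] by (rule order_trans)
    then show False using that(4) by (simp add: numeral_eq_enat)
  qed
  show ?thesis
  proof
    assume g: "3 \<le> gdist G a b"
    have "a \<noteq> b" using short[of "[a]"] g assms by (auto simp: walk_def)
    moreover have "{a, b} \<notin> edges G" using short[of "[a, b]"] g assms by (auto simp: walk_def)
    moreover have "\<not> ({a, y} \<in> edges G \<and> {y, b} \<in> edges G)" for y
      using short[of "[a, y, b]"] g assms ev by (auto simp: walk_def)
    ultimately show "a \<noteq> b \<and> {a, b} \<notin> edges G \<and> (\<nexists>y. {a, y} \<in> edges G \<and> {y, b} \<in> edges G)" by blast
  next
    assume far: "a \<noteq> b \<and> {a, b} \<notin> edges G \<and> (\<nexists>y. {a, y} \<in> edges G \<and> {y, b} \<in> edges G)"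
    have "4 \<le> length p" if p: "walk G p" "hd p = a" "last p = b" for p
    proof (rule ccontr)
      assume "\<not> 4 \<le> length p"
      then consider "p = []" | c where "p = [c]" | c d where "p = [c, d]" | c d e where "p = [c, d, e]"
        by (auto simp: not_le less_Suc_eq numeral_eq_Suc length_Suc_conv)
      then show False using p far by cases (auto simp: walk_def)
    qed
    then show "3 \<le> gdist G a b"
      unfolding gdist_def by (intro INF_greatest) (force simp: numeral_eq_enat)
  qed
qed

lemma gdist_0_iff:
  assumes "a \<in> verts G"
  shows "gdist G a b = 0 \<longleftrightarrow> a = b"
proof
  assume "a = b"
  then have "gdist G a b \<le> enat (length [a] - 1)" unfolding gdist_def
    using assms by (intro INF_lower) (auto simp: walk_def)
  then show "gdist G a b = 0" by (simp add: enat_0)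
next
  assume *: "gdist G a b = 0"
  show "a = b"
  proof (rule ccontr)
    assume "a \<noteq> b"
    then have "1 \<le> gdist G a b" unfolding gdist_def
    proof (intro INF_greatest)
      fix p assume "p \<in> {p. walk G p \<and> hd p = a \<and> last p = b}"
      then have "2 \<le> length p" using \<open>a \<noteq> b\<close>
        by (cases p rule: list.exhaust; cases "tl p") (auto simp: walk_def)
      then show "1 \<le> enat (length p - 1)" by (simp add: one_enat_def)
    qed
    then show False using * by simp
  qed
qed

lemma gdist_1_or_2_iff:
  assumes "simple_graph G" "a \<in> verts G" "b \<in> verts G"
  shows "gdist G a b = 1 \<or> gdist G a b = 2 \<longleftrightarrow>
    a \<noteq> b \<and> ({a, b} \<in> edges G \<or> (\<exists>y. {a, y} \<in> edges G \<and> {y, b} \<in> edges G))"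
proof -
  have "d = 1 \<or> d = 2 \<longleftrightarrow> d \<noteq> 0 \<and> \<not> 3 \<le> d" for d :: enat
    by (cases d) (auto simp: numeral_eq_enat one_enat_def zero_enat_def)
  then show ?thesis using gdist_ge_3_iff[OF assms] gdist_0_iff[OF assms(2), of b] by blast
qed

section \<open>Weak vertex sticking\<close>

definition stick :: "'a \<Rightarrow> 'a \<Rightarrow> 'a \<Rightarrow> 'a \<Rightarrow> 'a" where
  "stick u v w = (\<lambda>x. if x = u \<or> x = v then w else x)"

definition stick_graph :: "'a graph \<Rightarrow> 'a \<Rightarrow> 'a \<Rightarrow> 'a \<Rightarrow> 'a graph" where
  "stick_graph H u v w = Graph (insert w (verts H - {u, v}))
     ({e \<in> edges H. u \<notin> e \<and> v \<notin> e} \<union> {{w, x} |x. x \<in> neighborhood H u \<union> neighborhood H v})"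

context
  fixes H :: "'a graph" and u v w :: 'a
  assumes simple: "simple_graph H" and uv: "u \<in> verts H" "v \<in> verts H" "3 \<le> gdist H u v"
    and fresh: "w \<notin> verts H"
begin

lemma stuck_vertices_far: "u \<noteq> v" "{u, v} \<notin> edges H" "{u, y} \<in> edges H \<Longrightarrow> {v, y} \<notin> edges H"
  using gdist_ge_3_iff[OF simple uv(1,2)] uv(3) by (auto simp: insert_commute)

lemma simple_stick_graph: "simple_graph (stick_graph H u v w)"
proof -
  have "w \<notin> neighborhood H u" "w \<notin> neighborhood H v" using fresh by (auto simp: neighborhood_def)
  moreover have "x \<in> verts H" "x \<noteq> u" "x \<noteq> v" if "x \<in> neighborhood H u \<union> neighborhood H v" for x
    using that simple stuck_vertices_far fresh by (auto simp: neighborhood_def simple_graph_def insert_commute)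
  ultimately show ?thesis
    using simple unfolding stick_graph_def simple_graph_def by (auto simp: card_insert_if)
qed

lemma stick_graph_edge:
  assumes "e \<in> edges H" shows "stick u v w ` e \<in> edges (stick_graph H u v w)"
proof -
  obtain a b where ab: "e = {a, b}" "a \<noteq> b" "a \<in> verts H" "b \<in> verts H" using simple_edge[OF simple assms] by blast
  have n: "b \<in> neighborhood H a" "a \<in> neighborhood H b"
    using ab assms by (auto simp: neighborhood_def insert_commute)
  consider "a \<in> {u, v}" "b \<in> {u, v}" | "a \<in> {u, v}" "b \<notin> {u, v}" | "a \<notin> {u, v}" "b \<in> {u, v}" | "a \<notin> {u, v}" "b \<notin> {u, v}" by blast
  then show ?thesis
  proof cases
    case 1 then show ?thesis using ab assms stuck_vertices_far by (auto simp: insert_commute)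
  next
    case 2 then have "stick u v w ` e = {w, b}" using ab by (auto simp: stick_def)
    then show ?thesis using n 2 by (auto simp: stick_graph_def)
  next
    case 3 then have "stick u v w ` e = {w, a}" using ab by (auto simp: stick_def)
    then show ?thesis using n 3 by (auto simp: stick_graph_def)
  next
    case 4 then have "stick u v w ` e = e" using ab by (auto simp: stick_def)
    then show ?thesis using ab assms 4 by (auto simp: stick_graph_def)
  qed
qed

lemma stick_verts: "stick u v w ` verts H = verts (stick_graph H u v w)"
  using uv(1,2) by (auto simp: stick_def stick_graph_def)

lemma stick_graph_edge_cases:
  assumes "e \<in> edges (stick_graph H u v w)" shows "\<exists>e'\<in>edges H. e = stick u v w ` e'"
proof -
  from assms consider "e \<in> edges H" "u \<notin> e" "v \<notin> e" | x where "e = {w, x}" "x \<in> neighborhood H u \<union> neighborhood H v"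
    by (auto simp: stick_graph_def)
  then show ?thesis
  proof cases
    case 1 then have "stick u v w ` e = e" by (auto simp: stick_def image_iff)
    then show ?thesis using 1 by metis
  next
    case 2
    then obtain y where y: "y \<in> {u, v}" "{y, x} \<in> edges H" by (auto simp: neighborhood_def)
    then have "x \<noteq> u" "x \<noteq> v" using stuck_vertices_far simple by (auto simp: simple_graph_def insert_commute)
    then have "stick u v w ` {y, x} = e" using y 2 by (auto simp: stick_def)
    then show ?thesis using y by metis
  qed
qed

lemma triangle_not_both:
  assumes "t \<in> triangles H" "u \<in> t" shows "v \<notin> t"
  using triangle_edge[OF assms(1), of u v] stuck_vertices_far assms(2) by auto

lemma stick_inj_triangle:
  assumes "t \<in> triangles H" shows "inj_on (stick u v w) t"
proof -
  have "w \<notin> t" using assms fresh by (auto simp: triangles_def)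
  then show ?thesis using triangle_not_both[OF assms] unfolding stick_def inj_on_def by (auto split: if_splits)
qed

lemma stick_triangle:
  assumes "t \<in> triangles H" shows "stick u v w ` t \<in> triangles (stick_graph H u v w)"
proof -
  have "card (stick u v w ` t) = 3" using card_image[OF stick_inj_triangle[OF assms]] assms by (simp add: triangles_def)
  moreover have "stick u v w ` t \<subseteq> verts (stick_graph H u v w)"
    using assms unfolding stick_verts[symmetric] by (auto simp: triangles_def)
  moreover have "{stick u v w x, stick u v w y} \<in> edges (stick_graph H u v w)" if "x \<in> t" "y \<in> t" "x \<noteq> y" for x y
    using stick_graph_edge[of "{x, y}"] triangle_edge[OF assms, of x y] that by auto
  ultimately show ?thesis by (auto simp: triangles_def)
qed

text \<open>
  This is where distance three is needed: a common vertex of the two triangles would be a common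
  neighbour of \<open>u\<close> and \<open>v\<close>, so after the identification the triangles share just \<open>w\<close>.
\<close>

lemma stick_separate_triangles:
  assumes "s \<in> triangles H" "t \<in> triangles H" "u \<in> s" "v \<in> t"
  shows "s \<inter> t = {}" "stick u v w ` s \<inter> stick u v w ` t = {w}"
proof -
  have nuv: "v \<notin> s" "u \<notin> t" using triangle_not_both assms by blast+
  show "s \<inter> t = {}"
  proof (rule ccontr)
    assume "s \<inter> t \<noteq> {}"
    then obtain y where "y \<in> s" "y \<in> t" by blast
    then show False using stuck_vertices_far(3)[of y] triangle_edge[OF assms(1), of u y] triangle_edge[OF assms(2), of v y] assms nuv
      by (metis empty_subsetI insert_subset)
  qed
  moreover have "w \<notin> s" "w \<notin> t" using fresh assms by (auto simp: triangles_def)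
  ultimately show "stick u v w ` s \<inter> stick u v w ` t = {w}"
    using assms nuv by (auto simp: stick_def image_iff split: if_splits)
qed

text \<open>
  All a cycle of triangles depends on is whether two triangles share two vertices, and sticking
  respects this.
\<close>

lemma stick_card_Int:
  assumes "s \<in> triangles H" "t \<in> triangles H"
  shows "card (stick u v w ` s \<inter> stick u v w ` t) = card (s \<inter> t) \<or>
    card (stick u v w ` s \<inter> stick u v w ` t) \<le> 1 \<and> card (s \<inter> t) \<le> 1"
proof (cases "u \<in> s \<and> v \<in> t \<or> u \<in> t \<and> v \<in> s")
  case True
  then show ?thesis using stick_separate_triangles[of s t] stick_separate_triangles[of t s] assms by (auto simp: Int_commute)
next
  case False
  have "w \<notin> s" "w \<notin> t" using fresh assms by (auto simp: triangles_def)
  then have inj: "inj_on (stick u v w) (s \<union> t)"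
    using False triangle_not_both[OF assms(1)] triangle_not_both[OF assms(2)] unfolding stick_def inj_on_def
    by (auto split: if_splits)
  have "stick u v w ` s \<inter> stick u v w ` t = stick u v w ` (s \<inter> t)"
    using inj_on_image_Int[OF inj, of s t] by auto
  moreover have "card (stick u v w ` (s \<inter> t)) = card (s \<inter> t)"
    using inj by (intro card_image) (auto simp: inj_on_def)
  ultimately show ?thesis by simp
qed

lemma triangle_cycle_stick:
  assumes "triangle_cycle n t" "t ` {..<n} \<subseteq> triangles H"
  shows "triangle_cycle n (\<lambda>i. stick u v w ` t i)"
proof (rule triangle_cycleI)
  have t: "t i \<in> triangles H" if "i < n" for i using assms(2) that by auto
  {
    fix i assume "i < n"
    then show "card (stick u v w ` t i) = 3"
      using card_image[OF stick_inj_triangle[OF t]] triangle_cycle_card[OF assms(1)] by simp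
  next
    fix i j assume ij: "i < j" "j < n"
    note c = stick_card_Int[OF t[OF less_trans[OF ij]] t[OF ij(2)]]
    show "card (stick u v w ` t i \<inter> stick u v w ` t j) = 2" if "j = Suc i \<or> i = 0 \<and> Suc j = n"
      using c triangle_cycle_adj[OF assms(1) ij that] by linarith
    show "card (stick u v w ` t i \<inter> stick u v w ` t j) \<le> 1" if "\<not> (j = Suc i \<or> i = 0 \<and> Suc j = n)"
      using c triangle_cycle_nonadj[OF assms(1) ij that] by linarith
  }
qed

lemma induced_cycle_stick:
  assumes "induced_cycle (triangle_graph H) n S"
  shows "induced_cycle (triangle_graph (stick_graph H u v w)) n ((`) (stick u v w) ` S)"
proof -
  obtain t where t: "3 \<le> n" "triangle_cycle n t" "t ` {..<n} = S" "S \<subseteq> triangles H"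
    using assms unfolding induced_cycle_iff[OF simple] by blast
  then have "triangle_cycle n (\<lambda>i. stick u v w ` t i)" using triangle_cycle_stick by blast
  moreover have "(\<lambda>i. stick u v w ` t i) ` {..<n} = (`) (stick u v w) ` S" using t(3) by auto
  moreover have "(`) (stick u v w) ` S \<subseteq> triangles (stick_graph H u v w)" using stick_triangle t(4) by auto
  ultimately show ?thesis unfolding induced_cycle_iff[OF simple_stick_graph] using t(1) by blast
qed

end

lemma weak_vertex_sticking_induced_cycle:
  assumes "weak_vertex_sticking (H, S) (H', S')" "induced_cycle (triangle_graph H) n S"
  shows "simple_graph H' \<and> induced_cycle (triangle_graph H') n S'"
  using assms(1)
proof cases
  case (1 u v w)
  have "H' = stick_graph H u v w" "S' = (`) (stick u v w) ` S"
    unfolding 1(1,2) stick_graph_def stick_def by (rule refl)+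
  then show ?thesis
    using simple_stick_graph[OF 1(3,5-8)] induced_cycle_stick[OF 1(3,5-8) assms(2)] by simp
qed

lemma weak_vertex_stickings_induced_cycle:
  assumes "weak_vertex_sticking\<^sup>*\<^sup>* P Q" "simple_graph (fst P)" "induced_cycle (triangle_graph (fst P)) n (snd P)"
  shows "simple_graph (fst Q) \<and> induced_cycle (triangle_graph (fst Q)) n (snd Q)"
  using assms(1)
proof (induction rule: rtranclp_induct)
  case base then show ?case using assms by simp
next
  case (step Q R)
  then show ?case using weak_vertex_sticking_induced_cycle[of "fst Q" "snd Q" "fst R" "snd R" n] by simp
qed

section \<open>Strips and the starting graphs\<close>

text \<open>
  Vertex \<open>x (i + 1)\<close> is the one that is new in triangle \<open>i\<close>, and \<open>x i\<close> is the one that was new in the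
  preceding triangle; indices are cyclic.
\<close>

definition strip_triangle :: "nat \<Rightarrow> (nat \<Rightarrow> 'a) \<Rightarrow> (nat \<Rightarrow> 'a) \<Rightarrow> nat \<Rightarrow> 'a set" where
  "strip_triangle n x z i = {x i, x (Suc i mod n), z i}"

text \<open>
  The letter \<open>s ! i\<close> tells which vertex of triangle \<open>i\<close> besides \<open>x (i + 1)\<close> survives in the next
  triangle: \<open>x i\<close> (a switch) or \<open>z i\<close>. The vertices are distinct and the graph consists of the
  triangles only, so that the word determines the strip up to renaming.
\<close>

definition strip_word :: "bool list \<Rightarrow> (nat \<Rightarrow> 'a) \<Rightarrow> (nat \<Rightarrow> 'a) \<Rightarrow> 'a graph \<Rightarrow> 'a set set \<Rightarrow> bool" where
  "strip_word s x z H S \<longleftrightarrow>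
     simple_graph H \<and> inj_on x {..<length s} \<and> verts H = x ` {..<length s} \<and>
     (\<forall>i<length s. z (Suc i mod length s) = (if s ! i then x i else z i)) \<and>
     triangle_cycle (length s) (strip_triangle (length s) x z) \<and>
     strip_triangle (length s) x z ` {..<length s} = S \<and> S \<subseteq> triangles H \<and>
     (\<forall>e\<in>edges H. \<exists>t\<in>S. e \<subseteq> t)"

lemma simple_complete_graph: "simple_graph (complete_graph n)"
  by (auto simp: simple_graph_def complete_graph_def)

lemma simple_delete_edges: "simple_graph G \<Longrightarrow> simple_graph (delete_edges G F)"
  by (auto simp: simple_graph_def delete_edges_def)

lemma complete_graph_edge: "{i, j} \<in> edges (complete_graph n) \<longleftrightarrow> i < n \<and> j < n \<and> i \<noteq> j"
  by (auto simp: complete_graph_def doubleton_eq_iff)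

lemma path_graph_edge: "{i, j} \<in> edges (path_graph n) \<longleftrightarrow> i < n \<and> j < n \<and> (i = Suc j \<or> j = Suc i)"
  by (auto simp: path_graph_def doubleton_eq_iff)

lemma complete_graph_cover:
  assumes "\<forall>j<n. \<forall>i<j. {i, j} \<notin> edges F \<longrightarrow> (\<exists>t\<in>S. {i, j} \<subseteq> t)"
  shows "\<forall>e\<in>edges (delete_edges (complete_graph n) F). \<exists>t\<in>S. e \<subseteq> t"
proof
  fix e assume "e \<in> edges (delete_edges (complete_graph n) F)"
  then obtain i j where e: "e = {i, j}" "i < n" "j < n" "i \<noteq> j" "e \<notin> edges F"
    by (auto simp: delete_edges_def complete_graph_def)
  show "\<exists>t\<in>S. e \<subseteq> t"
  proof (cases "i < j")
    case True then show ?thesis using assms e by auto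
  next
    case False then show ?thesis using assms[rule_format, of i j] e by (auto simp: insert_commute)
  qed
qed

lemmas enumerate_nat = eval_nat_numeral All_less_Suc less_Suc_eq

lemma All_less_6: "(\<forall>i<6. P i) \<longleftrightarrow> P 0 \<and> P 1 \<and> P 2 \<and> P 3 \<and> P 4 \<and> P (5::nat)"
proof -
  have "i < 6 \<longleftrightarrow> i = 0 \<or> i = 1 \<or> i = 2 \<or> i = 3 \<or> i = 4 \<or> i = 5" for i :: nat by presburger
  then show ?thesis by auto
qed

lemma All_less_3: "(\<forall>i<3. P i) \<longleftrightarrow> P 0 \<and> P 1 \<and> P (2::nat)"
proof -
  have "i < 3 \<longleftrightarrow> i = 0 \<or> i = 1 \<or> i = 2" for i :: nat by presburger
  then show ?thesis by auto
qed

lemma triangle_cycle_bounded: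
  "triangle_cycle n t \<longleftrightarrow> (\<forall>i<n. card (t i) = 3) \<and>
     (\<forall>i<n. \<forall>j<n. i < j \<longrightarrow>
        (if j = Suc i \<or> i = 0 \<and> Suc j = n then card (t i \<inter> t j) = 2 else card (t i \<inter> t j) \<le> 1))"
  unfolding triangle_cycle_def by (intro conj_cong refl) (meson less_trans)

text \<open>
  Each of the independent vertices 0, 1, 2 lies in just two of the six triangles, and these share an
  edge from it to one of 3, 4, 5.
\<close>

lemma strip_K6_K3:
  "strip_word [True, False, True, False, True, False] ((!) [3, 0, 4, 1, 5, 2]) ((!) [5, 3, 3, 4, 4, 5])
     (delete_edges (complete_graph 6) (complete_graph 3))
     {{3, 0, 5}, {0, 4, 3}, {4, 1, 3}, {1, 5, 4}, {5, 2, 4}, {2, 3, 5}}" (is "strip_word ?s ?x ?z ?H ?S")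
  unfolding strip_word_def
proof (intro conjI)
  show "simple_graph ?H" by (intro simple_delete_edges simple_complete_graph)
  show "inj_on ?x {..<length ?s}" by (auto simp: inj_on_def enumerate_nat)
  show "verts ?H = ?x ` {..<length ?s}"
    by (auto simp: delete_edges_def complete_graph_def enumerate_nat lessThan_Suc)
  show "\<forall>i<length ?s. ?z (Suc i mod length ?s) = (if ?s ! i then ?x i else ?z i)"
  proof -
    have l: "length ?s = 6" by simp
    show ?thesis unfolding l All_less_6 by simp
  qed
  show "triangle_cycle (length ?s) (strip_triangle (length ?s) ?x ?z)"
  proof -
    have l: "length ?s = 6" by simp
    show ?thesis unfolding l triangle_cycle_bounded All_less_6 strip_triangle_def
      by (simp add: Int_insert_left)
  qed
  show "strip_triangle (length ?s) ?x ?z ` {..<length ?s} = ?S"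
  proof -
    have l: "length ?s = 6" "{..<6::nat} = {0, 1, 2, 3, 4, 5}" by auto
    show ?thesis unfolding l by (simp add: strip_triangle_def)
  qed
  show "?S \<subseteq> triangles ?H"
    unfolding triangles_def by (auto simp: delete_edges_def complete_graph_edge) (simp_all add: complete_graph_def)
  show "\<forall>e\<in>edges ?H. \<exists>t\<in>?S. e \<subseteq> t"
    by (rule complete_graph_cover) (simp add: complete_graph_edge enumerate_nat)
qed

text \<open>
  The path that is missing runs through 0, 1, 2, 3, and the pivots of the fans are 4, 5, 0 and 3;
  those at 4 and 5 have two triangles.
\<close>

lemma strip_K6_P4:
  "strip_word [True, False, True, False, True, True] ((!) [4, 1, 5, 2, 0, 3]) ((!) [3, 4, 4, 5, 5, 0])
     (delete_edges (complete_graph 6) (path_graph 4))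
     {{4, 1, 3}, {1, 5, 4}, {5, 2, 4}, {2, 0, 5}, {0, 3, 5}, {3, 4, 0}}" (is "strip_word ?s ?x ?z ?H ?S")
  unfolding strip_word_def
proof (intro conjI)
  show "simple_graph ?H" by (intro simple_delete_edges simple_complete_graph)
  show "inj_on ?x {..<length ?s}" by (auto simp: inj_on_def enumerate_nat)
  show "verts ?H = ?x ` {..<length ?s}"
    by (auto simp: delete_edges_def complete_graph_def enumerate_nat lessThan_Suc)
  show "\<forall>i<length ?s. ?z (Suc i mod length ?s) = (if ?s ! i then ?x i else ?z i)"
  proof -
    have l: "length ?s = 6" by simp
    show ?thesis unfolding l All_less_6 by simp
  qed
  show "triangle_cycle (length ?s) (strip_triangle (length ?s) ?x ?z)"
  proof -
    have l: "length ?s = 6" by simp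
    show ?thesis unfolding l triangle_cycle_bounded All_less_6 strip_triangle_def
      by (simp add: Int_insert_left)
  qed
  show "strip_triangle (length ?s) ?x ?z ` {..<length ?s} = ?S"
  proof -
    have l: "length ?s = 6" "{..<6::nat} = {0, 1, 2, 3, 4, 5}" by auto
    show ?thesis unfolding l by (simp add: strip_triangle_def)
  qed
  show "?S \<subseteq> triangles ?H"
    unfolding triangles_def by (auto simp: delete_edges_def complete_graph_edge path_graph_edge) (simp_all add: complete_graph_def)
  show "\<forall>e\<in>edges ?H. \<exists>t\<in>?S. e \<subseteq> t"
    by (rule complete_graph_cover) (simp add: path_graph_edge enumerate_nat)
qed

lemma cycle_graph_neighbours:
  assumes "{a, y} \<in> edges (cycle_graph m)" "2 \<le> m"
  shows "a < m" "y < m" "y = Suc a mod m \<or> y = (a + m - 1) mod m"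
proof -
  obtain i where i: "i < m" "{a, y} = {i, Suc i mod m}" using assms by (auto simp: cycle_graph_def)
  then show "a < m" "y < m" by (auto simp: doubleton_eq_iff)
  have "i = (Suc i mod m + m - 1) mod m" using i(1) assms(2) by (cases "Suc i = m") auto
  then show "y = Suc a mod m \<or> y = (a + m - 1) mod m" using i(2) by (auto simp: doubleton_eq_iff)
qed

lemma simple_square_graph: "simple_graph G \<Longrightarrow> simple_graph (square_graph G)"
  unfolding simple_graph_def square_graph_def
  by (auto simp: card_insert_if) (use gdist_0_iff in force)+

lemma square_graph_edge:
  assumes "simple_graph G"
  shows "{a, b} \<in> edges (square_graph G) \<longleftrightarrow>
    a \<noteq> b \<and> ({a, b} \<in> edges G \<or> (\<exists>y. {a, y} \<in> edges G \<and> {y, b} \<in> edges G))" (is "?l \<longleftrightarrow> ?r")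
proof
  assume ?l
  then obtain x y where xy: "{a, b} = {x, y}" "x \<in> verts G" "y \<in> verts G" "gdist G x y = 1 \<or> gdist G x y = 2"
    by (auto simp: square_graph_def)
  then have "x \<noteq> y \<and> ({x, y} \<in> edges G \<or> (\<exists>c. {x, c} \<in> edges G \<and> {c, y} \<in> edges G))"
    using gdist_1_or_2_iff[OF assms xy(2,3)] by blast
  then show ?r using xy(1) by (auto simp: doubleton_eq_iff insert_commute)
next
  assume r: ?r
  then have "a \<in> verts G" "b \<in> verts G" using assms by (auto simp: simple_graph_def)
  then show ?l using gdist_1_or_2_iff[OF assms, of a b] r by (auto simp: square_graph_def)
qed

lemma strip_triangle_square_cycle:
  assumes "i < m" shows "strip_triangle m (\<lambda>i. i) (\<lambda>i. (i + m - 1) mod m) i =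
    {if i = 0 then m - 1 else i - 1, i, if Suc i = m then 0 else Suc i}"
proof -
  have "(i + m - 1) mod m = (if i = 0 then m - 1 else i - 1)"
  proof (cases i)
    case (Suc k)
    then have "i + m - 1 = k + m" by simp
    then show ?thesis using Suc assms by simp
  qed (use assms in simp)
  then show ?thesis using assms by (auto simp: strip_triangle_def insert_commute)
qed

text \<open>
  The triangles are the triples of consecutive vertices of the cycle. Here every step is a switch:
  the vertex dropped is always the oldest one.
\<close>

lemma strip_square_cycle:
  assumes m: "5 \<le> m"
  defines "x \<equiv> \<lambda>i. i :: nat" and "z \<equiv> \<lambda>i. (i + m - 1) mod m"
  shows "strip_word (replicate m True) x z (square_graph (cycle_graph m)) (strip_triangle m x z ` {..<m})"
  unfolding strip_word_def length_replicate
proof (intro conjI ballI allI impI)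
  let ?T = "strip_triangle m x z"
  have simple: "simple_graph (cycle_graph m)" using simple_cycle_graph m by simp
  show "simple_graph (square_graph (cycle_graph m))" using simple simple_square_graph by blast
  show "inj_on x {..<m}" by (simp add: x_def)
  show V: "verts (square_graph (cycle_graph m)) = x ` {..<m}" by (simp add: x_def square_graph_def cycle_graph_def)
  show "z (Suc i mod m) = (if replicate m True ! i then x i else z i)" if "i < m" for i
    using that m by (cases "Suc i = m") (auto simp: z_def x_def)
  have T: "?T i = {if i = 0 then m - 1 else i - 1, i, if Suc i = m then 0 else Suc i}" if "i < m" for i
    unfolding x_def z_def by (rule strip_triangle_square_cycle[OF that])
  show "triangle_cycle m ?T"
  proof (rule triangle_cycleI)
    fix i assume "i < m" then show "card (?T i) = 3" unfolding T[OF \<open>i < m\<close>] using m by (auto simp: card_insert_if)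
  next
    fix i j assume ij: "i < j" "j < m"
    then have im: "i < m" by simp
    show "card (?T i \<inter> ?T j) = 2" if "j = Suc i \<or> i = 0 \<and> Suc j = m"
    proof -
      have "?T i \<inter> ?T j = {i, j}" unfolding T[OF im] T[OF ij(2)] using that ij m by (auto split: if_splits)
      then show ?thesis using ij by simp
    qed
    show "card (?T i \<inter> ?T j) \<le> 1" if "\<not> (j = Suc i \<or> i = 0 \<and> Suc j = m)"
    proof -
      have "?T i \<inter> ?T j \<subseteq> {if j = Suc (Suc i) then Suc i else if i = 0 then m - 1 else 0}"
        unfolding T[OF im] T[OF ij(2)] using that ij m
        by (cases "i = 0"; cases "Suc j = m") auto
      then show ?thesis using card_mono[of "{_}"] by fastforce
    qed
  qed
  have nxt: "{y, Suc y mod m} \<in> edges (cycle_graph m)" if "y < m" for y using that by (auto simp: cycle_graph_def)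
  have prv: "{(y + m - 1) mod m, y} \<in> edges (cycle_graph m)" if "y < m" for y
  proof -
    have "Suc ((y + m - 1) mod m) mod m = y" using that m by (cases y) (auto simp: mod_simps)
    then show ?thesis using nxt[of "(y + m - 1) mod m"] m by simp
  qed
  show "?T ` {..<m} \<subseteq> triangles (square_graph (cycle_graph m))"
  proof
    fix t assume "t \<in> ?T ` {..<m}"
    then obtain y where y: "y < m" "t = {y, Suc y mod m, (y + m - 1) mod m}" by (auto simp: strip_triangle_def x_def z_def)
    have "card t = 3" using T[OF y(1)] y m by (auto simp: strip_triangle_def x_def z_def card_insert_if)
    then have d: "y \<noteq> Suc y mod m" "y \<noteq> (y + m - 1) mod m" "Suc y mod m \<noteq> (y + m - 1) mod m"
      unfolding y(2) by (auto simp: card_insert_if split: if_splits)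
    have "t \<subseteq> x ` {..<m}" using y m by (auto simp: x_def)
    moreover have "{y, Suc y mod m} \<in> edges (square_graph (cycle_graph m))"
      "{(y + m - 1) mod m, y} \<in> edges (square_graph (cycle_graph m))"
      "{(y + m - 1) mod m, Suc y mod m} \<in> edges (square_graph (cycle_graph m))"
      unfolding square_graph_edge[OF simple] using nxt[OF y(1)] prv[OF y(1)] d by metis+
    ultimately show "t \<in> triangles (square_graph (cycle_graph m))"
      unfolding triangles_def V using \<open>card t = 3\<close> y(2) by (auto simp: insert_commute)
  qed
  fix e assume e: "e \<in> edges (square_graph (cycle_graph m))"
  obtain a b where ab: "e = {a, b}" using simple_edge[OF simple_square_graph[OF simple] e] by blast
  have in_T: "{c, c'} \<subseteq> ?T c" if "{c, c'} \<in> edges (cycle_graph m)" for c c'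
    using cycle_graph_neighbours[OF that] m by (auto simp: strip_triangle_def x_def z_def)
  from e consider "{a, b} \<in> edges (cycle_graph m)" | y where "{y, a} \<in> edges (cycle_graph m)" "{y, b} \<in> edges (cycle_graph m)"
    unfolding ab square_graph_edge[OF simple] by (auto simp: insert_commute)
  then show "\<exists>t\<in>?T ` {..<m}. e \<subseteq> t"
  proof cases
    case 1
    then show ?thesis using in_T[OF 1] cycle_graph_neighbours(1)[OF 1] m ab by auto
  next
    case 2
    then show ?thesis using in_T[OF 2(1)] in_T[OF 2(2)] cycle_graph_neighbours(1)[OF 2(1)] m ab by auto
  qed
qed simp

lemma induced_3_cycle_K4: "induced_cycle (triangle_graph (complete_graph 4)) 3 {{0,1,2},{0,1,3},{0,2,3}}"
proof -
  let ?t = "(!) [{0,1,2},{0,1,3},{0,2,3::nat}]"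
  have "triangle_cycle 3 ?t"
    unfolding triangle_cycle_bounded All_less_3 by (simp add: Int_insert_left card_insert_if)
  moreover have "?t ` {..<3} = {{0,1,2},{0,1,3},{0,2,3}}"
  proof -
    have "{..<3::nat} = {0, 1, 2}" by auto
    then show ?thesis by simp
  qed
  moreover have "{{0,1,2},{0,1,3},{0,2,3}} \<subseteq> triangles (complete_graph 4)"
    unfolding triangles_def by (auto simp: complete_graph_edge) (simp_all add: complete_graph_def)
  ultimately show ?thesis unfolding induced_cycle_iff[OF simple_complete_graph] by blast
qed

lemma induced_3_cycle_K5_K3: "induced_cycle (triangle_graph (delete_edges (complete_graph 5) (complete_graph 3))) 3 {{0,3,4},{1,3,4},{2,3,4}}"
proof -
  let ?t = "(!) [{0,3,4},{1,3,4},{2,3,4::nat}]"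
  have "triangle_cycle 3 ?t"
    unfolding triangle_cycle_bounded All_less_3 by (simp add: Int_insert_left card_insert_if)
  moreover have "?t ` {..<3} = {{0,3,4},{1,3,4},{2,3,4}}"
  proof -
    have "{..<3::nat} = {0, 1, 2}" by auto
    then show ?thesis by simp
  qed
  moreover have "{{0,3,4},{1,3,4},{2,3,4}} \<subseteq> triangles (delete_edges (complete_graph 5) (complete_graph 3))"
    unfolding triangles_def by (auto simp: complete_graph_edge delete_edges_def) (simp_all add: complete_graph_def)
  ultimately show ?thesis unfolding induced_cycle_iff[OF simple_delete_edges[OF simple_complete_graph]] by blast
qed

lemma wheel_graph_sel:
  "verts (wheel_graph n) = insert n {..<n}"
  "edges (wheel_graph n) = edges (cycle_graph n) \<union> {{n, y} |y. y < n}"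
  by (auto simp: wheel_graph_def join_graph_def cycle_graph_def)

lemma simple_wheel_graph: "3 \<le> n \<Longrightarrow> simple_graph (wheel_graph n)"
  using simple_cycle_graph[of n] unfolding simple_graph_def wheel_graph_sel
  by (auto simp: card_insert_if cycle_graph_def)

lemma induced_cycle_wheel:
  assumes "4 \<le> n" shows "\<exists>S. induced_cycle (triangle_graph (wheel_graph n)) n S"
proof -
  let ?t = "\<lambda>i. {n, i, if Suc i = n then 0 else Suc i}"
  have "triangle_cycle n ?t"
  proof (rule triangle_cycleI)
    fix i assume "i < n" then show "card (?t i) = 3" using assms by (auto simp: card_insert_if)
  next
    fix i j assume ij: "i < j" "j < n"
    show "card (?t i \<inter> ?t j) = 2" if "j = Suc i \<or> i = 0 \<and> Suc j = n"
    proof -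
      have "?t i \<inter> ?t j = {n, if j = Suc i then j else i}" using that ij assms by (auto split: if_splits)
      then show ?thesis using ij by simp
    qed
    show "card (?t i \<inter> ?t j) \<le> 1" if "\<not> (j = Suc i \<or> i = 0 \<and> Suc j = n)"
    proof (rule card_le_1I)
      fix a b assume "a \<in> ?t i \<inter> ?t j" "b \<in> ?t i \<inter> ?t j"
      then show "a = b" using that ij assms by (auto split: if_splits)
    qed
  qed
  moreover have "?t i \<in> triangles (wheel_graph n)" if "i < n" for i
  proof -
    have "{i, if Suc i = n then 0 else Suc i} = {i, Suc i mod n}" using that by auto
    then have "{i, if Suc i = n then 0 else Suc i} \<in> edges (cycle_graph n)" using that by (auto simp: cycle_graph_def)
    then show ?thesis
      using that assms unfolding triangles_def wheel_graph_sel
      by (auto simp: insert_commute card_insert_if)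
  qed
  ultimately show ?thesis
    using assms simple_wheel_graph[of n] induced_cycle_iff[of "wheel_graph n" n "?t ` {..<n}"] by auto
qed

lemma strip_word_induced_cycle:
  assumes "strip_word s x z H S" "3 \<le> length s"
  shows "induced_cycle (triangle_graph H) (length s) S"
proof -
  have "simple_graph H" using assms(1) by (simp add: strip_word_def)
  then show ?thesis
    unfolding induced_cycle_iff[OF \<open>simple_graph H\<close>] using assms unfolding strip_word_def by blast
qed

lemma strip_word_rotate1:
  assumes "strip_word s x z H S"
  shows "strip_word (rotate1 s) (\<lambda>i. x (Suc i mod length s)) (\<lambda>i. z (Suc i mod length s)) H S"
proof -
  let ?n = "length s" and ?r = "\<lambda>i. Suc i mod length s"
  have T: "strip_triangle ?n (\<lambda>i. x (?r i)) (\<lambda>i. z (?r i)) = (\<lambda>i. strip_triangle ?n x z (?r i))"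
    by (auto simp: strip_triangle_def)
  have im: "(\<lambda>i. f (?r i)) ` {..<?n} = f ` {..<?n}" for f :: "nat \<Rightarrow> 'b"
    by (subst (2) Suc_mod_image[symmetric]) (simp only: image_image)
  have "inj_on ?r {..<?n}" by (rule eq_card_imp_inj_on) (simp_all only: Suc_mod_image finite_lessThan)
  then have "inj_on (\<lambda>i. x (?r i)) {..<?n}"
    using comp_inj_on[of ?r "{..<?n}" x] assms unfolding Suc_mod_image by (simp add: strip_word_def comp_def)
  moreover have "z (?r (?r i)) = (if rotate1 s ! i then x (?r i) else z (?r i))" if "i < ?n" for i
  proof -
    have "?r i < ?n" using that by (intro mod_less_divisor) auto
    then show ?thesis using assms that by (simp add: strip_word_def nth_rotate1)
  qed
  moreover have "triangle_cycle ?n (\<lambda>i. strip_triangle ?n x z (?r i))"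
    using assms by (intro triangle_cycle_rotate1) (simp add: strip_word_def)
  ultimately show ?thesis
    using assms unfolding strip_word_def length_rotate1 T im by (intro conjI) (elim conjE, assumption | simp)+
qed

text \<open>
  Appending a non-switch enlarges the fan whose pivot is \<open>z 0\<close>. The last triangle contains \<open>x 0\<close> and
  the pivot; the edge from \<open>x 0\<close> to its remaining vertex \<open>v\<close> is private and gets split. Numbering the
  new vertex last keeps all other names and indices.
\<close>

lemma strip_word_split:
  assumes str: "strip_word s x z H S" and n4: "4 \<le> length s" and w: "w \<notin> verts H"
  shows "\<exists>x' z' H' S'. weak_edge_splitting (H, S) (H', S') \<and> strip_word (s @ [False]) x' z' H' S'"
proof -
  define n where "n = length s"
  define T where "T = strip_triangle n x z"
  have n: "4 \<le> n" using n4 by (simp add: n_def)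
  have n1: "n - 1 \<noteq> n" "Suc (n - 1) = n" "n - 1 < n" using n by auto
  have simple: "simple_graph H" and inj: "inj_on x {..<n}" and V: "verts H = x ` {..<n}"
    and rec: "\<And>i. i < n \<Longrightarrow> z (Suc i mod n) = (if s ! i then x i else z i)"
    and cyc: "triangle_cycle n T" and S: "T ` {..<n} = S" "S \<subseteq> triangles H"
    and cover: "\<And>e. e \<in> edges H \<Longrightarrow> \<exists>t\<in>S. e \<subseteq> t"
    using str unfolding strip_word_def n_def T_def by auto
  define u where "u = x 0"
  define p where "p = z 0"
  \<comment> \<open>v is the vertex of the last triangle that does not survive in triangle 0\<close>
  define v where "v = (if s ! (n - 1) then z (n - 1) else x (n - 1))"
  have p: "p = (if s ! (n - 1) then x (n - 1) else z (n - 1))"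
    using rec[of "n - 1"] n by (simp add: p_def)
  have Tn: "T (n - 1) = {u, v, p}" using n by (auto simp: T_def strip_triangle_def u_def v_def p)
  have Ti: "T i = {x i, x (Suc i), z i}" if "i < n - 1" for i using that by (simp add: T_def strip_triangle_def)
  have out: "{u, p} \<subseteq> T 0" using Ti[of 0] n by (auto simp: u_def p_def)
  have c3: "card {u, v, p} = 3" using triangle_cycle_card[OF cyc, of "n - 1"] n Tn by simp
  then have d: "u \<noteq> v" "u \<noteq> p" "v \<noteq> p" by (auto simp: card_insert_if split: if_splits)
  \<comment> \<open>Both neighbours of the last triangle contain the pivot p, so if one of them contained u and v as
      well, it would be the same triangle.\<close>
  have priv: "\<not> {u, v} \<subseteq> T i" if i: "i < n - 1" for i
  proof
    assume uv: "{u, v} \<subseteq> T i"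
    then have "i = n - 2 \<or> i = 0"
      using triangle_cycle_sharing[OF cyc, of i "n - 1" u v] Tn d i by auto
    then have "p \<in> T i"
    proof
      assume "i = 0" then show ?thesis using out by simp
    next
      assume i': "i = n - 2"
      have si: "Suc i = n - 1" using i' n by simp
      have "z (n - 1) = (if s ! i then x i else z i)" using rec[of i] i si by simp
      then show ?thesis using Ti[OF i] unfolding si p by auto
    qed
    then have "T (n - 1) \<subseteq> T i" using uv Tn by simp
    moreover have "finite (T i)" "card (T i) = card (T (n - 1))"
      using triangle_cycle_finite[OF cyc] triangle_cycle_card[OF cyc] i by auto
    ultimately have "T (n - 1) = T i" by (metis card_subset_eq)
    then have "n - 1 = i" using inj_onD[OF triangle_cycle_inj[OF cyc]] i by simp
    then show False using i by simp
  qed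
  have TS: "T i \<in> S" if "i < n" for i using S(1) that by auto
  have tri: "{u, v, p} \<in> triangles H" "{u, v, p} \<in> S" using TS[of "n - 1"] S(2) Tn n by auto
  have privS: "\<not> {u, v} \<subseteq> t" if t: "t \<in> S" "t \<noteq> {u, v, p}" for t
  proof -
    obtain i where "i < n" "t = T i" using t(1) S(1) by auto
    moreover from this have "i < n - 1" using t(2) Tn by (cases "i = n - 1") auto
    ultimately show ?thesis using priv by blast
  qed
  define H' where "H' = split_graph H u v p w"
  define S' where "S' = S - {{u, v, p}} \<union> {{u, w, p}, {w, v, p}}"
  define x' where "x' = x(n := w)"
  define z' where "z' = z(n := p)"
  have "{u, v} \<in> edges H" using triangle_edge[OF tri(1), of u v] d by simp
  moreover have "\<exists>!t. t \<in> S \<and> {u, v} \<subseteq> t"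
    by (rule ex1I[of _ "{u, v, p}"]) (use tri(2) privS in auto)
  ultimately have "private_edge H S {u, v}"
    unfolding private_edge_def by simp
  then have split: "weak_edge_splitting (H, S) (H', S')"
    unfolding H'_def S'_def split_graph_def
    using weak_edge_splitting.intros[OF simple _ tri(2) c3 _ w]
      specified_cycleI[OF simple strip_word_induced_cycle[OF str] n4] n4 by simp
  have fresh: "w \<notin> T i" if "i < n" for i using TS[OF that] S(2) w by (auto simp: triangles_def)
  have T': "strip_triangle (Suc n) x' z' i = (T(n - 1 := {v, w, p}, n := {u, w, p})) i" if i: "i < Suc n" for i
  proof -
    consider "i < n - 1" | "i = n - 1" | "i = n" using i by linarith
    then show ?thesis
    proof cases
      case 1
      then have "i < n" "Suc i < n" by auto
      then show ?thesis using 1 Ti[OF 1] by (simp add: strip_triangle_def x'_def z'_def)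
    next
      case 2
      have "strip_triangle (Suc n) x' z' i = {x (n - 1), w, z (n - 1)}"
        using 2 n1 by (simp add: strip_triangle_def x'_def z'_def)
      also have "\<dots> = {v, w, p}" unfolding v_def p by auto
      finally show ?thesis using 2 n1 by simp
    next
      case 3
      then show ?thesis using n by (auto simp: strip_triangle_def x'_def z'_def u_def)
    qed
  qed
  have cyc': "triangle_cycle (Suc n) (strip_triangle (Suc n) x' z')"
    using triangle_cycle_split[OF cyc n Tn priv out fresh] T' by (rule triangle_cycle_cong)
  have S'': "strip_triangle (Suc n) x' z' ` {..<Suc n} = S'"
  proof -
    have "strip_triangle (Suc n) x' z' ` {..<Suc n} = (T(n - 1 := {v, w, p}, n := {u, w, p})) ` {..<Suc n}"
      by (rule image_cong) (use T' in auto)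
    also have "\<dots> = S'" using split_images[OF cyc Tn, of w] n unfolding S(1) S'_def by simp
    finally show ?thesis .
  qed
  have S't: "S' \<subseteq> triangles H'"
  proof
    fix t assume "t \<in> S'"
    then consider "t \<in> S" "t \<noteq> {u, v, p}" | "t = {v, w, p}" | "t = {u, w, p}"
      unfolding S'_def by (auto simp: insert_commute)
    then show "t \<in> triangles H'"
      using triangles_split_graph[OF tri(1) w] S(2) privS[of t] unfolding H'_def by cases auto
  qed
  have cover': "\<exists>t\<in>S'. e \<subseteq> t" if e: "e \<in> edges H'" for e
  proof -
    from e consider "e \<in> edges H" "e \<noteq> {u, v}" | "e = {u, w}" | "e = {w, v}" | "e = {w, p}"
      unfolding H'_def split_graph_def by auto
    then show ?thesis
    proof cases
      case 1
      obtain t where t: "t \<in> S" "e \<subseteq> t" using cover 1 by blast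
      show ?thesis
      proof (cases "t = {u, v, p}")
        case True
        have "card e = 2" using simple 1(1) by (simp add: simple_graph_def)
        then have "\<not> e \<subseteq> {u, v}" using card_subset_eq[of "{u, v}" e] 1(2) d by auto
        moreover have "e = {u, p}" if "u \<in> e" "p \<in> e"
          using card_subset_eq[of e "{u, p}"] \<open>card e = 2\<close> that d by (simp add: card_ge_0_finite)
        ultimately have "e \<subseteq> {u, w, p} \<or> e \<subseteq> {w, v, p}" using t(2) unfolding True by blast
        then show ?thesis unfolding S'_def by blast
      next
        case False then show ?thesis using t by (auto simp: S'_def)
      qed
    qed (auto simp: S'_def)
  qed
  have x'_old: "x' ` {..<n} = x ` {..<n}" "inj_on x' {..<n}"
    using inj by (auto simp: x'_def inj_on_def)
  have x'_new: "x' n = w" by (simp add: x'_def)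
  have "verts H' = x' ` {..<Suc n}"
    unfolding H'_def split_graph_def lessThan_Suc image_insert x'_old(1) x'_new V graph.sel ..
  moreover have "x' n \<notin> x' ` ({..<n} - {n})"
    using w x'_old(1) unfolding x'_new V by auto
  then have "inj_on x' {..<Suc n}"
    unfolding lessThan_Suc inj_on_insert using x'_old(2) by blast
  moreover have "z' (Suc i mod Suc n) = (if (s @ [False]) ! i then x' i else z' i)" if i: "i < Suc n" for i
  proof -
    consider "i < n - 1" | "i = n - 1" | "i = n" using i by linarith
    then show ?thesis
    proof cases
      case 1
      then have "i < n" "Suc i < n" "i \<noteq> n" "Suc i \<noteq> n" by auto
      then show ?thesis using rec[of i] by (simp add: nth_append n_def[symmetric] x'_def z'_def)
    next
      case 2
      then show ?thesis using n1 p by (simp add: nth_append n_def[symmetric] x'_def z'_def)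
    next
      case 3
      then show ?thesis using n by (simp add: nth_append n_def[symmetric] x'_def z'_def p_def)
    qed
  qed
  moreover have "simple_graph H'" unfolding H'_def by (rule simple_split_graph[OF simple tri(1) w])
  ultimately have "strip_word (s @ [False]) x' z' H' S'"
    unfolding strip_word_def using cyc' S'' S't cover' by (simp add: n_def)
  then show ?thesis using split by blast
qed

section \<open>Words realized by splittings\<close>

text \<open>
  The starting graphs of the splittings, each with the length of its specified cycle.
\<close>

definition base_graphs :: "(nat graph \<times> nat) set" where
  "base_graphs = {(square_graph (cycle_graph m), m) |m. 5 \<le> m} \<union>
     {(delete_edges (complete_graph 6) (complete_graph 3), 6), (delete_edges (complete_graph 6) (path_graph 4), 6)}"

definition realizable :: "bool list \<Rightarrow> bool" where
  "realizable s \<longleftrightarrow> (\<exists>H0 m x z H S. (H0, m) \<in> base_graphs \<and> m \<le> length s \<and>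
     (H, S) \<in> splittings H0 m (length s - m) \<and> strip_word s x z H S)"

lemma realizable_length: "realizable s \<Longrightarrow> 5 \<le> length s"
  unfolding realizable_def base_graphs_def by auto

lemma realizable_base:
  assumes "strip_word s x z H S" "(H, length s) \<in> base_graphs"
  shows "realizable s"
proof -
  have "3 \<le> length s" using assms(2) by (auto simp: base_graphs_def)
  then have "(H, S) \<in> splittings H (length s) (length s - length s)"
    using strip_word_induced_cycle[OF assms(1)] by (auto simp: splittings_def)
  then show ?thesis unfolding realizable_def using assms by blast
qed

lemma realizable_replicate: "5 \<le> m \<Longrightarrow> realizable (replicate m True)"
  using realizable_base[OF strip_square_cycle] by (force simp: base_graphs_def)

lemma realizable_K6_K3: "realizable [True, False, True, False, True, False]"
  by (rule realizable_base[OF strip_K6_K3]) (simp add: base_graphs_def)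

lemma realizable_K6_P4: "realizable [True, False, True, False, True, True]"
  by (rule realizable_base[OF strip_K6_P4]) (simp add: base_graphs_def)

lemma realizable_append_False:
  assumes "realizable s" shows "realizable (s @ [False])"
proof -
  obtain H0 m x z H S where *: "(H0, m) \<in> base_graphs" "m \<le> length s"
    "(H, S) \<in> splittings H0 m (length s - m)" "strip_word s x z H S"
    using assms unfolding realizable_def by blast
  have "finite (verts H)" using *(4) by (simp add: strip_word_def simple_graph_def)
  then obtain w where "w \<notin> verts H" using ex_new_if_finite infinite_UNIV_nat by blast
  then obtain x' z' H' S' where s: "weak_edge_splitting (H, S) (H', S')" "strip_word (s @ [False]) x' z' H' S'"
    using strip_word_split[OF *(4)] realizable_length[OF assms] by fastforce
  have "(H', S') \<in> splittings H0 m (Suc (length s - m))"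
    using *(3) s(1) unfolding splittings_def by (auto intro: relcomppI)
  then have "(H', S') \<in> splittings H0 m (length (s @ [False]) - m)" using *(2) by (simp add: Suc_diff_le)
  moreover have "m \<le> length (s @ [False])" using *(2) by simp
  ultimately show ?thesis unfolding realizable_def using *(1) s(2) by blast
qed

lemma realizable_rotate: "realizable s \<Longrightarrow> realizable (rotate k s)"
proof (induction k)
  case (Suc k)
  then have "realizable (rotate k s)" by simp
  then show ?case unfolding realizable_def rotate_Suc length_rotate1 using strip_word_rotate1 by blast
qed simp

text \<open>
  A cyclic sequence has no distinguished first triangle. This turns insertion at the end of a word
  into insertion anywhere.
\<close>

lemma realizable_swap: "realizable (s @ t) \<Longrightarrow> realizable (t @ s)"
  using realizable_rotate[of "s @ t" "length s"] by (simp add: rotate_append)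

lemma realizable_insert: "realizable (s @ t) \<Longrightarrow> realizable (s @ replicate k False @ t)"
proof (induction k)
  case (Suc k)
  then have "realizable ((replicate k False @ t) @ s)" using realizable_swap by simp
  then have "realizable ((replicate k False @ t) @ s @ [False])" using realizable_append_False by fastforce
  then have "realizable ((s @ [False]) @ replicate k False @ t)" by (rule realizable_swap)
  then show ?case by simp
qed simp

text \<open>
  Any word arises from its switches by inserting non-switches, one after the other.
\<close>

lemma realizable_filter: "realizable (s @ filter (\<lambda>b. b) t) \<Longrightarrow> realizable (s @ t)"
proof (induction t arbitrary: s)
  case (Cons b t)
  show ?case
  proof (cases b)
    case True
    then have "realizable ((s @ [True]) @ t)" using Cons.prems by (intro Cons.IH) simp
    then show ?thesis using True by simp
  next
    case False
    then have "realizable (s @ t)" using Cons by simp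
    then show ?thesis using False realizable_insert[of s t 1] by simp
  qed
qed simp

lemma realizable_five: "5 \<le> length (filter (\<lambda>b. b) s) \<Longrightarrow> realizable s"
proof -
  assume *: "5 \<le> length (filter (\<lambda>b. b) s)"
  have "filter (\<lambda>b. b) s = replicate (length (filter (\<lambda>b. b) s)) True"
    by (induction s) auto
  then have "realizable ([] @ filter (\<lambda>b. b) s)" using realizable_replicate[OF *] by simp
  then show ?thesis using realizable_filter by fastforce
qed

lemma realizable_three:
  assumes "1 \<le> a" "1 \<le> b" "1 \<le> c"
  shows "realizable ((True # replicate a False) @ (True # replicate b False) @ (True # replicate c False))"
proof -
  obtain a' b' c' where abc: "a = Suc a'" "b = Suc b'" "c = Suc c'" using assms by (metis Suc_le_D One_nat_def)
  have "realizable ([True, False] @ replicate a' False @ [True, False, True, False])"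
    using realizable_insert[of "[True, False]"] realizable_K6_K3 by simp
  then have "realizable (([True, False] @ replicate a' False @ [True, False]) @ replicate b' False @ [True, False])"
    using realizable_insert[of "[True, False] @ replicate a' False @ [True, False]"] by simp
  then have "realizable (([True, False] @ replicate a' False @ [True, False] @ replicate b' False @ [True, False]) @ replicate c' False @ [])"
    by (intro realizable_insert) simp
  then show ?thesis unfolding abc by simp
qed

text \<open>
  The parameters count the non-switches in the four gaps; those of the starting word are 1, 1, 0, 0,
  and the gaps can be enlarged independently.
\<close>

lemma realizable_four_aux:
  assumes "1 \<le> a" "1 \<le> b"
  shows "realizable ((True # replicate a False) @ (True # replicate b False) @ (True # replicate c False) @ (True # replicate d False))"
proof -
  obtain a' b' where ab: "a = Suc a'" "b = Suc b'" using assms by (metis Suc_le_D One_nat_def)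
  have "realizable ([True, False] @ replicate a' False @ [True, False, True, True])"
    using realizable_insert[of "[True, False]"] realizable_K6_P4 by simp
  then have "realizable (([True, False] @ replicate a' False @ [True, False]) @ replicate b' False @ [True, True])"
    using realizable_insert[of "[True, False] @ replicate a' False @ [True, False]"] by simp
  then have "realizable (([True, False] @ replicate a' False @ [True, False] @ replicate b' False @ [True]) @ replicate c False @ [True])"
    by (intro realizable_insert) simp
  then have "realizable (([True, False] @ replicate a' False @ [True, False] @ replicate b' False @ [True] @ replicate c False @ [True]) @ replicate d False @ [])"
    by (intro realizable_insert) simp
  then show ?thesis unfolding ab by simp
qed

text \<open>
  Up to rotation the two nonempty gaps are the first two.
\<close>

lemma realizable_four:
  assumes "1 \<le> a \<or> 1 \<le> c" "1 \<le> b \<or> 1 \<le> d"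
  shows "realizable ((True # replicate a False) @ (True # replicate b False) @ (True # replicate c False) @ (True # replicate d False))"
    (is "realizable (?A @ ?B @ ?C @ ?D)")
proof -
  consider "1 \<le> a" "1 \<le> b" | "1 \<le> b" "1 \<le> c" | "1 \<le> c" "1 \<le> d" | "1 \<le> d" "1 \<le> a" using assms by blast
  then show ?thesis
  proof cases
    case 1 then show ?thesis by (rule realizable_four_aux)
  next
    case 2
    then have "realizable ((?B @ ?C @ ?D) @ ?A)" using realizable_four_aux[of b c d a] by simp
    then show ?thesis by (rule realizable_swap)
  next
    case 3
    then have "realizable ((?C @ ?D) @ ?A @ ?B)" using realizable_four_aux[of c d a b] by simp
    then have "realizable ((?A @ ?B) @ ?C @ ?D)" by (rule realizable_swap)
    then show ?thesis by simp
  next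
    case 4
    then have "realizable (?D @ ?A @ ?B @ ?C)" using realizable_four_aux[of d a b c] by simp
    then have "realizable ((?A @ ?B @ ?C) @ ?D)" by (rule realizable_swap)
    then show ?thesis by simp
  qed
qed

section \<open>Switches and fans in a cycle of triangles\<close>

text \<open>
  The indices run over all natural numbers with period \<open>n\<close>, so that a fan may extend beyond index
  \<open>n\<close> and successive indices need no reduction modulo \<open>n\<close>.
\<close>

locale triangle_strip =
  fixes n :: nat and T :: "nat \<Rightarrow> 'a set" and x z :: "nat \<Rightarrow> 'a"
  assumes n4: "4 \<le> n" and cyc: "triangle_cycle n T"
    and T: "T i = {x i, x (Suc i), z i}" and turn: "z (Suc i) = x i \<or> z (Suc i) = z i"
    and period: "x (i + n) = x i" "z (i + n) = z i"
begin

lemma period_mod: "x (i mod n) = x i" "z (i mod n) = z i"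
proof -
  have "x (i + k * n) = x i" "z (i + k * n) = z i" for i k
  proof (induction k)
    case (Suc k)
    { case 1 show ?case using Suc.IH(1) period(1)[of "i + k * n"] by (simp add: add.assoc add.commute[of n])
    next case 2 show ?case using Suc.IH(2) period(2)[of "i + k * n"] by (simp add: add.assoc add.commute[of n]) }
  qed simp_all
  from this[of "i mod n" "i div n"] show "x (i mod n) = x i" "z (i mod n) = z i" by simp_all
qed

lemma T_mod: "T (i mod n) = T i"
proof -
  have "x (Suc (i mod n)) = x (Suc i)"
    using period_mod(1)[of "Suc (i mod n)"] period_mod(1)[of "Suc i"] by (simp add: mod_Suc_eq)
  then show ?thesis unfolding T period_mod by simp
qed

lemma card_T: "card (T i) = 3"
  using triangle_cycle_card[OF cyc, of "i mod n"] n4 by (simp add: T_mod)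

lemma distinct_T: "x i \<noteq> x (Suc i)" "x i \<noteq> z i" "x (Suc i) \<noteq> z i"
  using card_T[of i] unfolding T by (auto simp: card_insert_if split: if_splits)

text \<open>
  Indices are compared by divisibility over the integers, where differences do not truncate.
\<close>

lemma share:
  assumes "a \<noteq> b" "{a, b} \<subseteq> T i" "{a, b} \<subseteq> T j"
  shows "int n dvd int j - int i \<or> int n dvd int j - int i - 1 \<or> int n dvd int j - int i + 1"
proof -
  have dvdI: "int n dvd int j - int i + c" if "int (j mod n) - int (i mod n) + c = d * int n" for c d
  proof -
    have "int j = int (j div n) * int n + int (j mod n)" "int i = int (i div n) * int n + int (i mod n)"
      by (simp_all flip: of_nat_mult of_nat_add)
    then have "int j - int i + c = (int (j div n) - int (i div n) + d) * int n"
      using that by (simp add: algebra_simps)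
    then show ?thesis by simp
  qed
  have m: "i mod n < n" "j mod n < n" using n4 by auto
  consider "i mod n = j mod n" | "i mod n < j mod n" | "j mod n < i mod n" by linarith
  then show ?thesis
  proof cases
    case 1 then show ?thesis using dvdI[of 0 0] by simp
  next
    case 2
    then have "j mod n = Suc (i mod n) \<or> i mod n = 0 \<and> Suc (j mod n) = n"
      using triangle_cycle_sharing[OF cyc m assms(1)] assms(2,3) by (simp add: T_mod)
    then show ?thesis using dvdI[of "-1" 0] dvdI[of 1 1] by auto
  next
    case 3
    then have "i mod n = Suc (j mod n) \<or> j mod n = 0 \<and> Suc (i mod n) = n"
      using triangle_cycle_sharing[OF cyc m(2,1) assms(1)] assms(2,3) by (simp add: T_mod)
    then show ?thesis using dvdI[of 1 0] dvdI[of "-1" "-1"] by auto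
  qed
qed

lemma not_dvd: "0 < k \<Longrightarrow> k < int n \<Longrightarrow> \<not> int n dvd k"
  by (simp add: zdvd_not_zless)

text \<open>
  Three triangles through the same edge are pairwise adjacent, which an induced cycle of length at
  least four excludes.
\<close>

lemma edge_in_two:
  assumes "a \<noteq> b" "{a, b} \<subseteq> T i" "{a, b} \<subseteq> T (Suc i)" "{a, b} \<subseteq> T j"
  shows "int n dvd int j - int i \<or> int n dvd int j - int i - 1"
proof (rule ccontr)
  assume no: "\<not> ?thesis"
  then have 1: "int n dvd int j - int i + 1" using share[OF assms(1,2,4)] by blast
  have "int n dvd int j - int (Suc i) \<or> int n dvd int j - int (Suc i) - 1 \<or> int n dvd int j - int (Suc i) + 1"
    using share[OF assms(1,3,4)] .
  then have "int n dvd int j - int i - 2" using no by (auto simp: algebra_simps)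
  from dvd_diff[OF 1 this] have "int n dvd 3" by simp
  then show False using n4 not_dvd[of 3] by simp
qed

text \<open>
  Two equal rim vertices would give a spoke that lies in more than two triangles.
\<close>

lemma wheel:
  assumes "\<And>i. z (Suc i) = z i"
  shows "inj_on x {..<n}" "z 0 \<notin> range x" "T i = {x i, x (Suc i), z 0}"
proof -
  have z: "z i = z 0" for i by (induction i) (simp_all add: assms)
  have T0: "T i = {x i, x (Suc i), z 0}" for i using T z[of i] by simp
  then show "T i = {x i, x (Suc i), z 0}" .
  have xz: "x i \<noteq> z 0" for i using distinct_T(2)[of i] z[of i] by simp
  then show "z 0 \<notin> range x" by (metis rangeE)
  show "inj_on x {..<n}"
  proof (rule linorder_inj_onI)
    fix i j assume ij: "i < j" "i \<in> {..<n}" "j \<in> {..<n}"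
    show "x i \<noteq> x j"
    proof
      assume eq: "x i = x j"
      \<comment> \<open>the triangle before triangle i, one period later so that the subtraction does not truncate\<close>
      define k where "k = i + n - 1"
      have k: "Suc k = i + n" using n4 by (simp add: k_def)
      have "x (Suc k) = x i" using period(1) k by simp
      moreover have in_T: "{z 0, x (Suc k)} \<subseteq> T k" "{z 0, x (Suc k)} \<subseteq> T (Suc k)" by (auto simp: T0)
      moreover have "{z 0, x j} \<subseteq> T j" "{z 0, x j} \<subseteq> T (j + n - 1)"
      proof -
        have "Suc (j + n - 1) = j + n" using n4 by simp
        then show "{z 0, x j} \<subseteq> T (j + n - 1)" using T0[of "j + n - 1"] period(1)[of j] by auto
      qed (auto simp: T0)
      ultimately have a: "int n dvd int j - int k \<or> int n dvd int j - int k - 1"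
        and b: "int n dvd int (j + n - 1) - int k \<or> int n dvd int (j + n - 1) - int k - 1"
        using edge_in_two[of "z 0" "x (Suc k)" k j] edge_in_two[of "z 0" "x (Suc k)" k "j + n - 1"] xz[of "Suc k"] eq
        by simp_all
      have e: "int j - int k - 1 = (int j - int i) - int n" "int j - int k = (int j - int i + 1) - int n"
        "int (j + n - 1) - int k = int j - int i" "int (j + n - 1) - int k - 1 = int j - int i - 1"
        using n4 k by auto
      have n0: "\<not> int n dvd int j - int i" using ij by (intro not_dvd) auto
      have drop: "int n dvd d" if "int n dvd d - int n" for d using dvd_add[OF that dvd_refl] by simp
      have "int n dvd (int j - int i + 1) - int n \<or> int n dvd (int j - int i) - int n"
        using a by (simp only: e(1)) (simp only: e(2))
      then have "int n dvd int j - int i + 1" using n0 drop by blast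
      moreover have "int n dvd int j - int i - 1" using b n0 unfolding e(3,4) by blast
      ultimately have "int n dvd (int j - int i + 1) - (int j - int i - 1)" by (rule dvd_diff)
      then have "int n dvd 2" by simp
      then show False using n4 not_dvd[of 2] by simp
    qed
  qed auto
qed

definition switch :: "nat \<Rightarrow> bool" where "switch i \<longleftrightarrow> z (Suc i) = x i"

lemma not_switch: "\<not> switch i \<Longrightarrow> z (Suc i) = z i"
  using turn by (auto simp: switch_def)

lemma switch_period: "switch (i + n) \<longleftrightarrow> switch i"
  unfolding switch_def using period(1)[of i] period(2)[of "Suc i"] by simp

text \<open>
  Between consecutive switches \<open>k\<close> and \<open>l\<close> all triangles contain \<open>x k\<close>, the pivot of this fan.
\<close>

definition fan :: "nat \<Rightarrow> nat \<Rightarrow> bool" where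
  "fan k l \<longleftrightarrow> k < l \<and> switch k \<and> switch l \<and> (\<forall>i. k < i \<longrightarrow> i < l \<longrightarrow> \<not> switch i)"

lemma fan_period: "fan k l \<Longrightarrow> fan (k + n) (l + n)"
  unfolding fan_def
proof (intro conjI allI impI)
  fix i assume *: "k < l \<and> switch k \<and> switch l \<and> (\<forall>i. k < i \<longrightarrow> i < l \<longrightarrow> \<not> switch i)" "k + n < i" "i < l + n"
  then have "k < i - n" "i - n < l" "i = (i - n) + n" by auto
  then show "\<not> switch i" using * switch_period by metis
qed (auto simp: switch_period)

lemma next_fan:
  assumes "switch k" "k < N" "switch N"
  shows "\<exists>l. fan k l \<and> l \<le> N"
proof -
  define l where "l = (LEAST l. k < l \<and> switch l)"
  have l: "k < l \<and> switch l" unfolding l_def by (rule LeastI[of _ N]) (use assms in auto)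
  have "\<not> switch i" if "k < i" "i < l" for i
    using not_less_Least[of i "\<lambda>l. k < l \<and> switch l"] that unfolding l_def by blast
  moreover have "l \<le> N" unfolding l_def by (rule Least_le) (use assms in auto)
  ultimately show ?thesis using l assms(1) unfolding fan_def by blast
qed

lemma fan_pivot:
  assumes "fan k l" "k < i" "i \<le> l" shows "z i = x k"
  using assms(2,3)
proof (induction i)
  case (Suc i)
  show ?case
  proof (cases "i = k")
    case True then show ?thesis using assms(1) by (simp add: fan_def switch_def)
  next
    case False
    then have "\<not> switch i" using Suc.prems assms(1) by (simp add: fan_def)
    then show ?thesis using not_switch Suc False by simp
  qed
qed simp

text \<open>
  The next pivot \<open>x l\<close> is a neighbour of the pivot \<open>x k\<close>, and the edge between them already lies in
  two triangles. The lemmas below play this edge off against a third triangle that contains it.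
\<close>

lemma fan_edge:
  assumes "fan k l"
  shows "x k \<noteq> x l" "{x k, x l} \<subseteq> T l" "{x k, x l} \<subseteq> T (l - 1)"
proof -
  have kl: "k < l" using assms by (simp add: fan_def)
  have zl: "z l = x k" using fan_pivot[OF assms kl] by simp
  then show "x k \<noteq> x l" using distinct_T(2)[of l] by simp
  show "{x k, x l} \<subseteq> T l" using zl T[of l] by simp
  obtain l' where l': "l = Suc l'" using kl by (cases l) auto
  have "x k \<in> T l'"
  proof (cases "k = l'")
    case False
    then have "z l' = x k" using fan_pivot[OF assms, of l'] kl l' by simp
    then show ?thesis using T[of l'] by simp
  qed (simp add: T)
  then show "{x k, x l} \<subseteq> T (l - 1)" using l' T[of l'] by simp
qed

text \<open>
  If a switch is followed immediately by another one, the triangle of the first contains the pivots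
  before and after the short fan between them.
\<close>

lemma short_fan_edge:
  assumes "fan a b" "fan b (Suc b)"
  shows "x a \<noteq> x (Suc b)" "{x a, x (Suc b)} \<subseteq> T b"
proof -
  have "z b = x a" using fan_pivot[OF assms(1)] assms(1) by (simp add: fan_def)
  then show "x a \<noteq> x (Suc b)" "{x a, x (Suc b)} \<subseteq> T b" using distinct_T(3)[of b] T[of b] by auto
qed

lemma fan_edge_in_two:
  assumes "fan k l" "{x k, x l} \<subseteq> T j"
  shows "int n dvd int l - int j \<or> int n dvd int l - int j - 1"
proof -
  have "Suc (l - 1) = l" using assms(1) by (simp add: fan_def)
  then have "int n dvd int j - int (l - 1) \<or> int n dvd int j - int (l - 1) - 1" "int (l - 1) = int l - 1"
    using edge_in_two[OF fan_edge(1)[OF assms(1)] fan_edge(3)[OF assms(1)] _ assms(2)] fan_edge(2)[OF assms(1)]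
    by auto
  then have "int n dvd - (int l - int j - 1) \<or> int n dvd - (int l - int j)" by (simp add: algebra_simps)
  then show ?thesis unfolding dvd_minus_iff by blast
qed

lemma one_fan: "\<not> fan k (k + n)"
  using fan_edge(1)[of k "k + n"] period(1) by auto

text \<open>
  With two pivots only, both changes of fan happen at the same edge.
\<close>

lemma two_fans: "fan a b \<Longrightarrow> fan b (a + n) \<Longrightarrow> False"
proof -
  assume f: "fan a b" "fan b (a + n)"
  then have ab: "a < b" "b < a + n" by (auto simp: fan_def)
  have e: "{x b, x (a + n)} = {x a, x b}" using period by auto
  have 1: "int n dvd int (a + n) - int b \<or> int n dvd int (a + n) - int b - 1"
    using fan_edge_in_two[OF f(2), of b] fan_edge(2)[OF f(1)] e by simp
  have 2: "int n dvd int b - int (a + n) \<or> int n dvd int b - int (a + n) - 1"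
    using fan_edge_in_two[OF f(1), of "a + n"] fan_edge(2)[OF f(2)] e by simp
  have "\<not> int n dvd int (a + n) - int b" using ab by (intro not_dvd) auto
  moreover from this have "\<not> int n dvd int b - int (a + n)" by (metis dvd_minus_iff minus_diff_eq)
  ultimately have "int n dvd int (a + n) - int b - 1" "int n dvd int b - int (a + n) - 1" using 1 2 by blast+
  from dvd_add[OF this] have "int n dvd - 2" by simp
  then have "int n dvd 2" using dvd_minus_iff by blast
  then show False using n4 not_dvd[of 2] by simp
qed

text \<open>
  With three pivots, the pivots before and after a short fan also follow each other directly on the
  other side, so the edge between them lies in too many triangles.
\<close>

lemma three_fans: "fan a b \<Longrightarrow> fan b (Suc b) \<Longrightarrow> fan (Suc b) (a + n) \<Longrightarrow> False"
proof -
  assume f: "fan a b" "fan b (Suc b)" "fan (Suc b) (a + n)"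
  then have ab: "a < b" "Suc b < a + n" by (auto simp: fan_def)
  have "{x (Suc b), x (a + n)} \<subseteq> T b" using short_fan_edge(2)[OF f(1,2)] period(1)[of a] by simp
  then have "int n dvd int (a + n) - int b \<or> int n dvd int (a + n) - int b - 1"
    using fan_edge_in_two[OF f(3)] by blast
  then show False using not_dvd[of "int (a + n) - int b"] not_dvd[of "int (a + n) - int b - 1"] ab by auto
qed

text \<open>
  With four pivots, two opposite short fans produce the same edge between the other two pivots, in
  triangles that are not consecutive.
\<close>

lemma four_fans:
  "fan a b \<Longrightarrow> fan b (Suc b) \<Longrightarrow> fan (Suc b) c \<Longrightarrow> fan c (Suc c) \<Longrightarrow> Suc c = a + n \<Longrightarrow> False"
proof -
  assume f: "fan a b" "fan b (Suc b)" "fan (Suc b) c" "fan c (Suc c)" and c: "Suc c = a + n"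
  then have ab: "a < b" "Suc b < c" by (auto simp: fan_def)
  have "{x a, x (Suc b)} \<subseteq> T c" using short_fan_edge(2)[OF f(3,4)] period(1)[of a] c by auto
  then have "int n dvd int c - int b \<or> int n dvd int c - int b - 1 \<or> int n dvd int c - int b + 1"
    using share[OF short_fan_edge[OF f(1,2)]] by blast
  then show False
    using not_dvd[of "int c - int b"] not_dvd[of "int c - int b - 1"] not_dvd[of "int c - int b + 1"] ab c by auto
qed

lemma fan_word: "fan k l \<Longrightarrow> map switch [k..<l] = True # replicate (l - k - 1) False"
proof -
  assume f: "fan k l"
  then have "[k..<l] = k # [Suc k..<l]" by (simp add: fan_def upt_conv_Cons)
  moreover have "map switch [Suc k..<l] = replicate (l - k - 1) False"
    by (rule nth_equalityI) (use f in \<open>auto simp: fan_def\<close>)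
  ultimately show ?thesis using f by (simp add: fan_def)
qed

lemma fan_split: "fan k l \<Longrightarrow> l \<le> N \<Longrightarrow> map switch [k..<N] = (True # replicate (l - k - 1) False) @ map switch [l..<N]"
proof -
  assume f: "fan k l" "l \<le> N"
  then have "[k..<N] = [k..<l] @ [l..<N]" using upt_add_eq_append[of k l "N - l"] by (simp add: fan_def)
  then show ?thesis using fan_word[OF f(1)] by (simp only: map_append)
qed

text \<open>
  Following the fans from the switch at 0, the number of switches in one period is found to be three,
  four or at least five.
\<close>

lemma realizable_switches:
  assumes s0: "switch 0"
  shows "realizable (map switch [0..<n])"
proof -
  have sn: "switch n" using s0 switch_period[of 0] by simp
  obtain a where a: "fan 0 a" "a \<le> n" using next_fan[OF s0 _ sn] n4 by auto
  have "a \<noteq> n" using one_fan[of 0] a(1) by auto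
  then have an: "a < n" using a(2) by simp
  have sw: "switch l" if "fan k l" for k l using that by (simp add: fan_def)
  obtain b where b: "fan a b" "b \<le> n" using next_fan[OF sw[OF a(1)] an sn] by blast
  have "b \<noteq> n" using two_fans[of 0 a] a(1) b(1) by auto
  then have bn: "b < n" using b(2) by simp
  obtain c where c: "fan b c" "c \<le> n" using next_fan[OF sw[OF b(1)] bn sn] by blast
  note split3 = fan_split[OF a] fan_split[OF b] fan_split[OF c]
  have less: "0 < a" "a < b" "b < c" using a(1) b(1) c(1) by (auto simp: fan_def)
  show ?thesis
  proof (cases "c = n")
    case True
    have c': "fan b n" using c(1) True by simp
    have "a \<noteq> 1"
    proof
      assume "a = 1"
      then show False
        using three_fans[of b n] c' fan_period[OF a(1)] fan_period[OF b(1)] by simp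
    qed
    moreover have "b \<noteq> Suc a" using three_fans[of 0 a] a(1) b(1) c' by auto
    moreover have "n \<noteq> Suc b" using three_fans[of a b] b(1) c' fan_period[OF a(1)] by auto
    ultimately show ?thesis
      using realizable_three[of "a - 0 - 1" "b - a - 1" "c - b - 1"] less True unfolding split3 by simp
  next
    case False
    then have cn: "c < n" using c(2) by simp
    obtain d where d: "fan c d" "d \<le> n" using next_fan[OF sw[OF c(1)] cn sn] by blast
    have cd: "c < d" using d(1) by (simp add: fan_def)
    show ?thesis
    proof (cases "d = n")
      case True
      have d': "fan c n" using d(1) True by simp
      have "\<not> (b = Suc a \<and> n = Suc c)" using four_fans[of 0 a c] a(1) b(1) c(1) d' by auto
      moreover have "\<not> (a = 1 \<and> c = Suc b)"
      proof
        assume ac: "a = 1 \<and> c = Suc b"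
        have "fan n (Suc n)" using fan_period[OF a(1)] ac by simp
        moreover have "fan (Suc n) (b + n)" using fan_period[OF b(1)] ac by simp
        moreover have "fan (b + n) (Suc (b + n))" using fan_period[OF c(1)] ac by simp
        moreover have "Suc (b + n) = c + n" using ac by simp
        ultimately show False by (rule four_fans[OF d'])
      qed
      ultimately have "1 \<le> a - 0 - 1 \<or> 1 \<le> c - b - 1" "1 \<le> b - a - 1 \<or> 1 \<le> d - c - 1"
        using less cd True by linarith+
      from realizable_four[OF this] show ?thesis
        unfolding split3 fan_split[OF d] using True by simp
    next
      case False
      then have dn: "d < n" using d(2) by simp
      then have "[d..<n] = d # [Suc d..<n]" by (simp add: upt_conv_Cons)
      then have "map switch [d..<n] = True # map switch [Suc d..<n]" using sw[OF d(1)] by simp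
      then have "5 \<le> length (filter (\<lambda>b. b) (map switch [0..<n]))"
        unfolding split3 fan_split[OF d] by simp
      then show ?thesis by (rule realizable_five)
    qed
  qed
qed

end

text \<open>
  Let \<open>y j\<close> be the vertex of triangle \<open>j + 1\<close> that is not in triangle \<open>j\<close>. It is still present in
  triangle \<open>j + 2\<close>: otherwise triangles \<open>j\<close> and \<open>j + 2\<close> would both contain the edge shared by
  triangles \<open>j\<close> and \<open>j + 1\<close>. So triangle \<open>j + 2\<close> contains both \<open>y j\<close>
  and \<open>y (j + 1)\<close>, and its third vertex is the candidate for \<open>z\<close>.
\<close>

lemma triangle_strip_exists:
  assumes n: "4 \<le> n" and t: "triangle_cycle n t"
  shows "\<exists>x z. triangle_strip n (\<lambda>i. t (i mod n)) x z"
proof -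
  define T where "T = (\<lambda>i. t (i mod n))"
  have period: "T (i + n) = T i" for i by (simp add: T_def)
  have card_T: "card (T i) = 3" and fin: "finite (T i)" for i
    using triangle_cycle_card[OF t] triangle_cycle_finite[OF t] n by (auto simp: T_def)
  have rot: "triangle_cycle n (\<lambda>i. T (i + k))" for k
    using triangle_cycle_rotate(1)[OF t, of k] by (simp add: T_def)
  have adj: "card (T i \<inter> T (Suc i)) = 2" for i
    using triangle_cycle_adj[OF rot[of i], of 0 1] n by simp
  have nonadj: "card (T i \<inter> T (Suc (Suc i))) \<le> 1" for i
    using triangle_cycle_nonadj[OF rot[of i], of 0 2] n by (simp add: numeral_2_eq_2)
  define y where "y j = (SOME a. a \<in> T (Suc j) - T j)" for j
  have y: "y j \<in> T (Suc j)" "y j \<notin> T j" for j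
  proof -
    have "T (Suc j) \<noteq> T j \<inter> T (Suc j)" using adj[of j] card_T[of "Suc j"] by auto
    then have "\<exists>a. a \<in> T (Suc j) - T j" by blast
    then have "y j \<in> T (Suc j) - T j" unfolding y_def by (rule someI_ex)
    then show "y j \<in> T (Suc j)" "y j \<notin> T j" by auto
  qed
  have y2: "y j \<in> T (Suc (Suc j))" for j
  proof (rule ccontr)
    assume no: "y j \<notin> T (Suc (Suc j))"
    have "T (Suc j) - {y j} = T j \<inter> T (Suc j)"
      using y[of j] adj[of j] card_T[of "Suc j"] fin by (intro card_subset_eq[symmetric]) auto
    moreover have "T (Suc j) - {y j} = T (Suc j) \<inter> T (Suc (Suc j))"
      using no y(1)[of j] adj[of "Suc j"] card_T[of "Suc j"] fin by (intro card_subset_eq[symmetric]) auto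
    ultimately have "T j \<inter> T (Suc j) \<subseteq> T j \<inter> T (Suc (Suc j))" by blast
    from card_mono[OF _ this] show False using adj[of j] nonadj[of j] fin by simp
  qed
  define c where "c j = (SOME a. T (Suc (Suc j)) = {y j, y (Suc j), a})" for j
  have c: "T (Suc (Suc j)) = {y j, y (Suc j), c j}" for j
  proof -
    have ne: "y j \<noteq> y (Suc j)" using y(1)[of j] y(2)[of "Suc j"] by auto
    have sub: "{y j, y (Suc j)} \<subseteq> T (Suc (Suc j))" using y(1)[of "Suc j"] y2[of j] by simp
    have "card (T (Suc (Suc j)) - {y j, y (Suc j)}) = 1"
      using card_Diff_subset[OF _ sub] card_T ne by simp
    then obtain a where "T (Suc (Suc j)) - {y j, y (Suc j)} = {a}" by (auto simp: card_1_singleton_iff)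
    then have "T (Suc (Suc j)) = {y j, y (Suc j), a}" using sub by blast
    then show ?thesis unfolding c_def by (rule someI)
  qed
  have turn: "c (Suc j) = y j \<or> c (Suc j) = c j" for j
  proof -
    let ?A = "T (Suc (Suc j))" and ?B = "T (Suc (Suc (Suc j)))"
    have "?A \<inter> ?B \<subseteq> {y (Suc j), c (Suc j)}"
      using c[of "Suc j"] y(2)[of "Suc (Suc j)"] by auto
    moreover have "card {y (Suc j), c (Suc j)} \<le> 2" by (simp add: card_insert_if)
    ultimately have "?A \<inter> ?B = {y (Suc j), c (Suc j)}"
      using adj[of "Suc (Suc j)"] by (intro card_seteq) auto
    then have "c (Suc j) \<in> ?A" by blast
    moreover have "c (Suc j) \<noteq> y (Suc j)"
      using card_T[of "Suc (Suc (Suc j))"] c[of "Suc j"] by (auto simp: card_insert_if split: if_splits)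
    ultimately show ?thesis using c[of j] by auto
  qed
  have yp: "y (j + n) = y j" for j unfolding y_def using period[of "Suc j"] period[of j] by simp
  have cp: "c (j + n) = c j" for j
    unfolding c_def using period[of "Suc (Suc j)"] yp[of j] yp[of "Suc j"] by simp
  \<comment> \<open>n - 2 stands for the shift by -2, as all sequences have period n\<close>
  have "triangle_strip n T (\<lambda>i. y (i + (n - 2))) (\<lambda>i. c (i + (n - 2)))"
  proof
    show "triangle_cycle n T" using rot[of 0] by simp
    show "T i = {y (i + (n - 2)), y (Suc i + (n - 2)), c (i + (n - 2))}" for i
    proof -
      have "Suc (Suc (i + (n - 2))) = i + n" using n by simp
      then have "T i = T (Suc (Suc (i + (n - 2))))" by (simp only: period)
      then show ?thesis using c[of "i + (n - 2)"] by simp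
    qed
    show "c (Suc i + (n - 2)) = y (i + (n - 2)) \<or> c (Suc i + (n - 2)) = c (i + (n - 2))" for i
      using turn[of "i + (n - 2)"] by simp
    show "y (i + n + (n - 2)) = y (i + (n - 2))" "c (i + n + (n - 2)) = c (i + (n - 2))" for i
      using yp[of "i + (n - 2)"] cp[of "i + (n - 2)"] by (simp_all add: ac_simps)
  qed (rule n)
  then show ?thesis unfolding T_def by blast
qed

context triangle_strip
begin

lemma shift: "triangle_strip n (\<lambda>i. T (i + k)) (\<lambda>i. x (i + k)) (\<lambda>i. z (i + k))"
proof
  show "triangle_cycle n (\<lambda>i. T (i + k))" using triangle_cycle_rotate(1)[OF cyc, of k] by (simp add: T_mod)
  show "x (i + n + k) = x (i + k)" "z (i + n + k) = z (i + k)" for i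
    using period[of "i + k"] by (simp_all add: ac_simps)
qed (use n4 T turn in auto)

lemma wheel_subgraph:
  assumes G: "simple_graph G" and tri: "\<And>i. T i \<in> triangles G" and no: "\<And>i. \<not> switch i"
  shows "has_subgraph_isomorphic_to G (wheel_graph n)"
proof -
  note w = wheel[OF not_switch[OF no]]
  define g where "g = (\<lambda>i. if i = n then z 0 else x i)"
  have gx: "g i = x i" if "i < n" for i using that by (simp add: g_def)
  have "inj_on g {..<n}" using w(1) gx by (simp add: inj_on_def)
  moreover have "g n \<notin> g ` {..<n}"
  proof
    assume "g n \<in> g ` {..<n}"
    then obtain i where "i < n" "z 0 = x i" by (auto simp: g_def)
    then show False using w(2) by auto
  qed
  ultimately have inj: "inj_on g (verts (wheel_graph n))" unfolding wheel_graph_sel by simp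
  have in_G: "x i \<in> verts G" "z 0 \<in> verts G" for i
    using tri[of i] w(3)[of i] by (auto simp: triangles_def)
  have e1: "{x i, x (Suc i)} \<in> edges G" for i
    using triangle_edge[OF tri[of i]] distinct_T(1)[of i] w(3)[of i] by simp
  have e2: "{z 0, x i} \<in> edges G" for i
    using triangle_edge[OF tri[of i], of "z 0" "x i"] w(2,3) by (metis insertI1 insert_commute rangeI empty_subsetI insert_subset)
  have "g ` e \<in> edges G" if "e \<in> edges (wheel_graph n)" for e
  proof -
    from that consider i where "i < n" "e = {i, Suc i mod n}" | i where "i < n" "e = {n, i}"
      unfolding wheel_graph_sel cycle_graph_def by auto
    then show ?thesis
    proof cases
      case 1
      have "Suc i mod n < n" using n4 by simp
      then have "g ` e = {x i, x (Suc i)}" using 1 gx period_mod(1)[of "Suc i"] by simp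
      then show ?thesis using e1 by simp
    next
      case 2
      then have "g ` e = {z 0, x i}" using gx by (auto simp: g_def)
      then show ?thesis using e2 by simp
    qed
  qed
  moreover have "g ` verts (wheel_graph n) \<subseteq> verts G" using in_G by (auto simp: g_def)
  moreover have "simple_graph (wheel_graph n)" using simple_wheel_graph n4 by simp
  ultimately show ?thesis using inj has_subgraph_iff_embedding by blast
qed

text \<open>
  A strip with the same word follows the same recursion as \<open>z\<close>. The switch at 0 anchors it, since it
  determines the third vertex of triangle 1 by a vertex on which the map is given.
\<close>

lemma strip_map:
  assumes str: "strip_word (map switch [0..<n]) a b H S" and s0: "switch 0"
  shows "\<exists>\<phi>. \<forall>i<n. \<phi> (a i) = x i \<and> \<phi> ` strip_triangle n a b i = T i"
proof -
  define \<phi> where "\<phi> = x \<circ> inv_into {..<n} a"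
  have inj: "inj_on a {..<n}" and rec: "\<And>i. i < n \<Longrightarrow> b (Suc i mod n) = (if switch i then a i else b i)"
    using str by (auto simp: strip_word_def)
  have \<phi>a: "\<phi> (a i) = x i" if "i < n" for i using inj that by (simp add: \<phi>_def)
  have step: "\<phi> (b (Suc i mod n)) = z (Suc i)" if "i < n" "switch i \<or> \<phi> (b i) = z i" for i
    using that rec[OF that(1)] \<phi>a[OF that(1)] not_switch[of i] by (auto simp: switch_def)
  have \<phi>b: "\<phi> (b (Suc i mod n)) = z (Suc i)" if "i < n" for i
    using that
  proof (induction i)
    case 0 then show ?case using step[of 0] s0 by simp
  next
    case (Suc i) then show ?case using step[of "Suc i"] by simp
  qed
  have \<phi>b': "\<phi> (b i) = z i" if "i < n" for i
  proof (cases i)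
    case 0
    have "Suc (n - 1) = n" using n4 by simp
    then show ?thesis using \<phi>b[of "n - 1"] period(2)[of 0] n4 0 by simp
  next
    case (Suc k) then show ?thesis using \<phi>b[of k] that by simp
  qed
  have "\<phi> ` strip_triangle n a b i = T i" if "i < n" for i
  proof -
    have "\<phi> (a (Suc i mod n)) = x (Suc i)" using \<phi>a[of "Suc i mod n"] period_mod(1) n4 by simp
    then show ?thesis using that \<phi>a \<phi>b' T[of i] by (simp add: strip_triangle_def)
  qed
  then show ?thesis using \<phi>a by blast
qed

end

section \<open>Sticking vertices until a map is injective\<close>

text \<open>
  A map that may identify vertices, but only ones that lie far apart from each other in the cycle of
  triangles: it creates no common vertices for triangles that share an edge in the image.
\<close>

definition local_map :: "('a \<Rightarrow> 'b) \<Rightarrow> 'a set set \<Rightarrow> bool" where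
  "local_map f S \<longleftrightarrow> (\<forall>t\<in>S. inj_on f t) \<and>
     (\<forall>s\<in>S. \<forall>t\<in>S. 2 \<le> card (f ` s \<inter> f ` t) \<longrightarrow> f ` s \<inter> f ` t \<subseteq> f ` (s \<inter> t))"

text \<open>
  Both sequences have the same pattern of pairs with two common vertices.
\<close>

lemma local_mapI:
  assumes t: "triangle_cycle n t" and T: "triangle_cycle n T" and f: "\<And>i. i < n \<Longrightarrow> f ` t i = T i"
  shows "local_map f (t ` {..<n})"
proof -
  have inj: "inj_on f (t i)" if "i < n" for i
    using f[OF that] triangle_cycle_card[OF t that] triangle_cycle_card[OF T that] triangle_cycle_finite[OF t that]
    by (intro eq_card_imp_inj_on) auto
  have *: "T i \<inter> T j \<subseteq> f ` (t i \<inter> t j)" if "i < j" "j < n" "2 \<le> card (T i \<inter> T j)" for i j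
  proof -
    have i: "i < n" using that by simp
    have adj: "j = Suc i \<or> i = 0 \<and> Suc j = n" using triangle_cycle_nonadj[OF T that(1,2)] that(3) by fastforce
    have "card (f ` (t i \<inter> t j)) = card (t i \<inter> t j)"
      by (rule card_image) (rule inj_on_subset[OF inj[OF i]], simp)
    then have "card (f ` (t i \<inter> t j)) = card (T i \<inter> T j)"
      using triangle_cycle_adj[OF t that(1,2) adj] triangle_cycle_adj[OF T that(1,2) adj] by simp
    moreover have "f ` (t i \<inter> t j) \<subseteq> T i \<inter> T j" using f[OF i] f[OF that(2)] by blast
    ultimately show ?thesis
      using triangle_cycle_finite[OF T i] by (metis card_subset_eq finite_Int order_refl)
  qed
  have "f ` t i \<inter> f ` t j \<subseteq> f ` (t i \<inter> t j)" if "i < n" "j < n" "2 \<le> card (f ` t i \<inter> f ` t j)" for i j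
    using *[of i j] *[of j i] that f by (cases i j rule: linorder_cases) (auto simp: Int_commute)
  then show ?thesis using inj unfolding local_map_def by auto
qed

text \<open>
  If \<open>a\<close> and \<open>b\<close> had a common neighbour \<open>y\<close>, then the triangles through \<open>{a, y}\<close> and \<open>{y, b}\<close> would
  share an edge in the image, and a common vertex of these triangles mapped to \<open>f a\<close> would have to be
  both \<open>a\<close> and \<open>b\<close>.
\<close>

lemma local_map_far:
  assumes "local_map f S" "simple_graph H" "S \<subseteq> triangles H" "\<forall>e\<in>edges H. \<exists>t\<in>S. e \<subseteq> t"
    "a \<in> verts H" "b \<in> verts H" "a \<noteq> b" "f a = f b"
  shows "3 \<le> gdist H a b"
  unfolding gdist_ge_3_iff[OF assms(2,5,6)]
proof (intro conjI notI)
  have inj: "c = d" if "t \<in> S" "c \<in> t" "d \<in> t" "f c = f d" for c d t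
    using assms(1) that unfolding local_map_def by (meson inj_onD)
  show "a = b \<Longrightarrow> False" using assms by simp
  show False if "{a, b} \<in> edges H" using assms(4,7,8) that inj by (metis insert_subset)
  assume "\<exists>y. {a, y} \<in> edges H \<and> {y, b} \<in> edges H"
  then obtain y s t where y: "{a, y} \<in> edges H" and s: "s \<in> S" "{a, y} \<subseteq> s" and t: "t \<in> S" "{y, b} \<subseteq> t"
    using assms(4) by meson
  have "a \<noteq> y" using y assms(2) by (force simp: simple_graph_def)
  then have "f a \<noteq> f y" using inj[OF s(1)] s(2) by auto
  moreover have "finite s" using s(1) assms(3) triangle_finite by blast
  moreover have fa: "f a \<in> f ` s \<inter> f ` t" "f y \<in> f ` s \<inter> f ` t"
    using imageI[of a s f] imageI[of b t f] imageI[of y s f] imageI[of y t f] s t assms(8) by auto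
  ultimately have "2 \<le> card (f ` s \<inter> f ` t)" by (intro card_two_le) auto
  then have "f a \<in> f ` (s \<inter> t)" using assms(1) s(1) t(1) fa unfolding local_map_def by blast
  then obtain m where m: "m \<in> s" "m \<in> t" "f m = f a" by auto
  then have "m = a" "m = b" using inj[OF s(1), of m a] inj[OF t(1), of m b] s t assms(8) by auto
  then show False using assms(7) by simp
qed

text \<open>
  The map factors through the identification of two vertices with the same image, so one sticking
  reduces the number of vertices and the induction continues with the factor map.
\<close>

lemma stickings_to_subgraph:
  fixes H :: "nat graph"
  assumes "simple_graph H" "induced_cycle (triangle_graph H) n S" "4 \<le> n"
    "\<forall>e\<in>edges H. \<exists>t\<in>S. e \<subseteq> t" "local_map f S" "f ` verts H \<subseteq> verts G" "\<forall>e\<in>edges H. f ` e \<in> edges G"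
  shows "\<exists>H' S'. weak_vertex_sticking\<^sup>*\<^sup>* (H, S) (H', S') \<and> has_subgraph_isomorphic_to G H'"
  using assms
proof (induction "card (verts H)" arbitrary: H S f rule: less_induct)
  case less
  note simple = less.prems(1)
  show ?case
  proof (cases "inj_on f (verts H)")
    case True
    then have "has_subgraph_isomorphic_to G H"
      unfolding has_subgraph_iff_embedding[OF simple] using less.prems by blast
    then show ?thesis by blast
  next
    case False
    then obtain a b where ab: "a \<in> verts H" "b \<in> verts H" "a \<noteq> b" "f a = f b" by (auto simp: inj_on_def)
    have S: "S \<subseteq> triangles H" using less.prems(2) unfolding induced_cycle_iff[OF simple] by blast
    have far: "3 \<le> gdist H a b" by (rule local_map_far[OF less.prems(5) simple S less.prems(4) ab])
    have fin: "finite (verts H)" using simple by (simp add: simple_graph_def)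
    then obtain w where w: "w \<notin> verts H" using ex_new_if_finite infinite_UNIV_nat by blast
    note c = simple ab(1,2) far w
    define H1 where "H1 = stick_graph H a b w"
    define S1 where "S1 = (`) (stick a b w) ` S"
    define f1 where "f1 = f(w := f a)"
    have stick: "weak_vertex_sticking (H, S) (H1, S1)"
      unfolding H1_def S1_def stick_graph_def stick_def
      using weak_vertex_sticking.intros[OF simple specified_cycleI[OF simple less.prems(2,3)] ab(1,2) far w] .
    have f1: "f1 (stick a b w y) = f y" if "y \<in> verts H" for y
      using that w ab(4) by (auto simp: f1_def stick_def)
    have f1_im: "f1 ` stick a b w ` A = f ` A" if "A \<subseteq> verts H" for A
      using that f1 by (auto simp: image_image subset_iff intro!: image_cong)
    have card: "card (verts H1) < card (verts H)"
    proof -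
      have "card (verts H - {a, b}) = card (verts H) - 2"
        using ab fin by (simp add: card_Diff_subset)
      moreover have "2 \<le> card (verts H)" using ab fin by (intro card_two_le)
      moreover have "card (verts H1) = Suc (card (verts H - {a, b}))"
        using w fin by (simp add: H1_def stick_graph_def)
      ultimately show ?thesis by linarith
    qed
    have sub: "t \<subseteq> verts H" if "t \<in> S" for t using that S by (auto simp: triangles_def)
    have simple1: "simple_graph H1" unfolding H1_def by (rule simple_stick_graph[OF c])
    have cyc1: "induced_cycle (triangle_graph H1) n S1"
      unfolding H1_def S1_def by (rule induced_cycle_stick[OF c less.prems(2)])
    have cover1: "\<forall>e\<in>edges H1. \<exists>t\<in>S1. e \<subseteq> t"
    proof
      fix e assume "e \<in> edges H1"
      then obtain e' where "e' \<in> edges H" "e = stick a b w ` e'"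
        unfolding H1_def using stick_graph_edge_cases[OF c] by blast
      moreover from this obtain t where "t \<in> S" "e' \<subseteq> t" using less.prems(4) by blast
      ultimately show "\<exists>t\<in>S1. e \<subseteq> t" unfolding S1_def by blast
    qed
    have local1: "local_map f1 S1"
      unfolding local_map_def
    proof (intro conjI ballI impI)
      fix t assume "t \<in> S1"
      then obtain t' where t': "t' \<in> S" "t = stick a b w ` t'" by (auto simp: S1_def)
      have "inj_on f t'" using less.prems(5) t'(1) by (simp add: local_map_def)
      then have "inj_on (f1 \<circ> stick a b w) t'" using f1 sub[OF t'(1)] by (auto simp: inj_on_def subset_iff)
      then show "inj_on f1 t" unfolding t'(2) by (rule inj_on_imageI)
    next
      fix s t assume "s \<in> S1" "t \<in> S1" and two: "2 \<le> card (f1 ` s \<inter> f1 ` t)"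
      then obtain s' t' where st: "s' \<in> S" "t' \<in> S" "s = stick a b w ` s'" "t = stick a b w ` t'" by (auto simp: S1_def)
      have im: "f1 ` s = f ` s'" "f1 ` t = f ` t'" unfolding st by (simp_all add: f1_im sub st)
      have "f ` s' \<inter> f ` t' \<subseteq> f ` (s' \<inter> t')" using less.prems(5) st(1,2) two unfolding im local_map_def by blast
      also have "\<dots> = f1 ` stick a b w ` (s' \<inter> t')" by (rule f1_im[symmetric]) (use sub[OF st(1)] in auto)
      also have "\<dots> \<subseteq> f1 ` (s \<inter> t)" unfolding st by blast
      finally show "f1 ` s \<inter> f1 ` t \<subseteq> f1 ` (s \<inter> t)" unfolding im .
    qed
    have verts1: "f1 ` verts H1 \<subseteq> verts G"
      unfolding H1_def stick_verts[OF c, symmetric] f1_im[OF order_refl] by (rule less.prems(6))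
    have edges1: "\<forall>e\<in>edges H1. f1 ` e \<in> edges G"
    proof
      fix e assume "e \<in> edges H1"
      then obtain e' where e': "e' \<in> edges H" "e = stick a b w ` e'"
        unfolding H1_def using stick_graph_edge_cases[OF c] by blast
      have "e' \<subseteq> verts H" using e'(1) simple by (simp add: simple_graph_def)
      then show "f1 ` e \<in> edges G" unfolding e'(2) f1_im[OF \<open>e' \<subseteq> verts H\<close>] using less.prems(7) e'(1) by blast
    qed
    obtain H' S' where "weak_vertex_sticking\<^sup>*\<^sup>* (H1, S1) (H', S')" "has_subgraph_isomorphic_to G H'"
      using less.hyps[OF card simple1 cyc1 less.prems(3) cover1 local1 verts1 edges1] by blast
    then show ?thesis using stick by (meson converse_rtranclp_into_rtranclp)
  qed
qed

lemma strip_word_closed_neighbourhood: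
  assumes str: "strip_word s x z H S" and n: "3 \<le> length s" and a: "a \<in> verts H"
  shows "\<exists>A. A \<subseteq> verts H \<and> 4 \<le> card A \<and> (\<forall>y\<in>A. y = a \<or> {a, y} \<in> edges H)"
proof -
  define n where "n = length s"
  define T where "T = strip_triangle n x z"
  have cyc: "triangle_cycle n T" and V: "verts H = x ` {..<n}" and tri: "T ` {..<n} \<subseteq> triangles H"
    using str by (auto simp: strip_word_def n_def T_def)
  obtain i where i: "i < n" "a = x i" using a V by auto
  then have "i \<in> (\<lambda>k. Suc k mod n) ` {..<n}" unfolding Suc_mod_image by simp
  then obtain k where k: "k < n" "Suc k mod n = i" by blast
  have "k \<noteq> i" using k n by (cases "Suc k = n") (auto simp: n_def)
  then have ne: "T k \<noteq> T i" using inj_onD[OF triangle_cycle_inj[OF cyc]] k(1) i(1) by blast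
  have aT: "a \<in> T k" "a \<in> T i" using i k by (auto simp: T_def strip_triangle_def)
  have t: "T k \<in> triangles H" "T i \<in> triangles H" using tri i k by auto
  have f: "finite (T k)" "finite (T i)" "card (T k) = 3" "card (T i) = 3"
    using t triangle_finite by (auto simp: triangles_def)
  have "card (T k \<inter> T i) \<noteq> 3" using f ne by (metis card_subset_eq inf_le1 inf_le2)
  moreover have "card (T k \<inter> T i) \<le> 3" using f by (metis card_mono inf_le1)
  ultimately have "4 \<le> card (T k \<union> T i)" using card_Un_Int[OF f(1,2)] f by linarith
  moreover have "y = a \<or> {a, y} \<in> edges H" if "y \<in> T k \<union> T i" for y
    using that aT triangle_edge[OF t(1), of a y] triangle_edge[OF t(2), of a y] by auto
  moreover have "T k \<union> T i \<subseteq> verts H" using t by (auto simp: triangles_def)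
  ultimately show ?thesis by blast
qed

text \<open>
  The closed neighbourhoods of the two vertices are disjoint and have at least four elements each.
\<close>

lemma far_vertices_strip:
  assumes str: "strip_word s x z H S" and n: "3 \<le> length s"
    and ab: "a \<in> verts H" "b \<in> verts H" "3 \<le> gdist H a b"
  shows "8 \<le> length s"
proof -
  have simple: "simple_graph H" and V: "verts H = x ` {..<length s}" "inj_on x {..<length s}"
    using str by (auto simp: strip_word_def)
  have far: "a \<noteq> b" "{a, b} \<notin> edges H" "\<And>y. {a, y} \<in> edges H \<Longrightarrow> {y, b} \<notin> edges H"
    using ab(3) gdist_ge_3_iff[OF simple ab(1,2)] by blast+
  obtain A where A: "A \<subseteq> verts H" "4 \<le> card A" "\<And>y. y \<in> A \<Longrightarrow> y = a \<or> {a, y} \<in> edges H"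
    using strip_word_closed_neighbourhood[OF str n ab(1)] by blast
  obtain B where B: "B \<subseteq> verts H" "4 \<le> card B" "\<And>y. y \<in> B \<Longrightarrow> y = b \<or> {b, y} \<in> edges H"
    using strip_word_closed_neighbourhood[OF str n ab(2)] by blast
  have fin: "finite (verts H)" using simple by (simp add: simple_graph_def)
  have "False" if "y \<in> A" "y \<in> B" for y
    using A(3)[OF that(1)] B(3)[OF that(2)] far(1,2) far(3)[of y] by (auto simp: insert_commute)
  then have "A \<inter> B = {}" by blast
  then have "card (A \<union> B) = card A + card B" using A(1) B(1) fin by (intro card_Un_disjoint) (auto intro: finite_subset)
  moreover have "card (A \<union> B) \<le> card (verts H)" using A(1) B(1) fin by (intro card_mono) auto
  moreover have "card (verts H) = length s" using V by (simp add: card_image)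
  ultimately show ?thesis using A(2) B(2) by linarith
qed

section \<open>The forbidden subgraphs\<close>

lemma base_graphs_simple: "(H0, m) \<in> base_graphs \<Longrightarrow> simple_graph H0 \<and> 4 \<le> m"
  unfolding base_graphs_def
  using simple_square_graph[OF simple_cycle_graph] simple_delete_edges[OF simple_complete_graph] by auto

lemma base_graph_induced_cycle:
  assumes "(H0, m) \<in> base_graphs" shows "\<exists>S. induced_cycle (triangle_graph H0) m S"
proof -
  from assms consider "5 \<le> m" "H0 = square_graph (cycle_graph m)"
    | "m = 6" "H0 = delete_edges (complete_graph 6) (complete_graph 3)"
    | "m = 6" "H0 = delete_edges (complete_graph 6) (path_graph 4)"
    unfolding base_graphs_def by blast
  then have "\<exists>s x z S. strip_word s x z H0 S \<and> length s = m \<and> 3 \<le> m"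
  proof cases
    case 1
    then show ?thesis using strip_square_cycle[OF 1(1)] by (intro exI[of _ "replicate m True"]) auto
  next
    case 2
    show ?thesis unfolding 2 by (intro exI conjI, rule strip_K6_K3) simp_all
  next
    case 3
    show ?thesis unfolding 3 by (intro exI conjI, rule strip_K6_P4) simp_all
  qed
  then show ?thesis using strip_word_induced_cycle by blast
qed

lemma base_splittings_induced_cycle:
  assumes "(H0, m) \<in> base_graphs" "(H, S) \<in> splittings H0 m (n - m)" "m \<le> n"
  shows "simple_graph H \<and> induced_cycle (triangle_graph H) n S"
  using splittings_induced_cycle[OF assms(2)] base_graphs_simple[OF assms(1)] assms(3) by simp

text \<open>
  For smaller \<open>n\<close> the subtraction \<open>n - 6\<close> truncates, and the equation fails.
\<close>

lemma split_graphs_eq: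
  assumes "6 \<le> n"
  shows "split_graphs n = (\<Union>(H0, m)\<in>{(H0, m) \<in> base_graphs. m \<le> n}. splittings H0 m (n - m))"
proof -
  have "{(H0, m) \<in> base_graphs. m \<le> n} = (\<lambda>m. (square_graph (cycle_graph m), m)) ` {5..n} \<union>
     {(delete_edges (complete_graph 6) (complete_graph 3), 6), (delete_edges (complete_graph 6) (path_graph 4), 6)}"
    unfolding base_graphs_def using assms by auto
  then show ?thesis unfolding split_graphs_def by auto
qed

lemma split_graphs_induced_cycle:
  assumes "6 \<le> n" "(H, S) \<in> split_graphs n"
  shows "simple_graph H \<and> induced_cycle (triangle_graph H) n S"
  using assms(2) base_splittings_induced_cycle[of _ _ H S n] unfolding split_graphs_eq[OF assms(1)] by blast

lemma stuck_graphs_induced_cycle: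
  assumes "6 \<le> n" "(H, S) \<in> stuck_graphs n"
  shows "simple_graph H \<and> induced_cycle (triangle_graph H) n S"
proof -
  obtain P where "P \<in> split_graphs n" "weak_vertex_sticking\<^sup>*\<^sup>* P (H, S)"
    using assms(2) unfolding stuck_graphs_def by blast
  then show ?thesis
    using weak_vertex_stickings_induced_cycle[of P "(H, S)" n] split_graphs_induced_cycle[OF assms(1), of "fst P" "snd P"]
    by simp
qed

lemma splittings_0: "(H, S) \<in> splittings H0 m 0 \<longleftrightarrow> H = H0 \<and> induced_cycle (triangle_graph H0) m S"
  unfolding splittings_def by auto

lemma forbidden_induced_cycle:
  assumes "3 \<le> n" "H \<in> forbidden_subgraphs n"
  shows "simple_graph H \<and> (\<exists>S. induced_cycle (triangle_graph H) n S)"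
proof -
  have wheel: "simple_graph (wheel_graph n) \<and> (\<exists>S. induced_cycle (triangle_graph (wheel_graph n)) n S)" if "4 \<le> n"
    using simple_wheel_graph induced_cycle_wheel that by simp
  have base: "simple_graph H0 \<and> (\<exists>S. induced_cycle (triangle_graph H0) n S)" if "(H0, n) \<in> base_graphs" for H0
    using base_graphs_simple[OF that] base_graph_induced_cycle[OF that] by blast
  consider "n = 3" | "n = 4" | "n = 5" | "n = 6" | "7 \<le> n" using assms(1) by linarith
  then show ?thesis
  proof cases
    case 1
    then have "H = complete_graph 4 \<or> H = delete_edges (complete_graph 5) (complete_graph 3)"
      using assms(2) by (simp add: forbidden_subgraphs_def)
    then show ?thesis
      using 1 induced_3_cycle_K4 induced_3_cycle_K5_K3 simple_complete_graph simple_delete_edges by blast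
  next
    case 2
    then show ?thesis using assms(2) wheel by (simp add: forbidden_subgraphs_def)
  next
    case 3
    then have "H = wheel_graph n \<or> (H, n) \<in> base_graphs"
      using assms(2) by (auto simp: forbidden_subgraphs_def base_graphs_def)
    then show ?thesis using wheel base 3 by auto
  next
    case 4
    then have "H = wheel_graph n \<or> (H, n) \<in> base_graphs \<or> (\<exists>S. (H, S) \<in> splittings (square_graph (cycle_graph 5)) 5 (n - 5))"
      using assms(2) by (auto simp: forbidden_subgraphs_def base_graphs_def)
    moreover have "(square_graph (cycle_graph 5), 5) \<in> base_graphs" by (simp add: base_graphs_def)
    ultimately show ?thesis using wheel base base_splittings_induced_cycle[of _ 5 H _ n] 4 by auto
  next
    case 5
    then have "H = wheel_graph n \<or> (\<exists>S. (H, S) \<in> split_graphs n) \<or> (\<exists>S. (H, S) \<in> stuck_graphs n)"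
      using assms(2) by (auto simp: forbidden_subgraphs_def)
    moreover have "6 \<le> n" "4 \<le> n" using 5 by auto
    ultimately show ?thesis
      using wheel split_graphs_induced_cycle[of n H] stuck_graphs_induced_cycle[of n H] by blast
  qed
qed

lemma complete_minus_subgraph:
  assumes "distinct vs" "set vs \<subseteq> verts G"
    "\<And>i j. i < j \<Longrightarrow> j < length vs \<Longrightarrow> {i, j} \<notin> edges F \<Longrightarrow> {vs ! i, vs ! j} \<in> edges G"
  shows "has_subgraph_isomorphic_to G (delete_edges (complete_graph (length vs)) F)"
  unfolding has_subgraph_iff_embedding[OF simple_delete_edges[OF simple_complete_graph]]
proof (intro exI conjI ballI)
  have V: "verts (delete_edges (complete_graph (length vs)) F) = {..<length vs}"
    by (simp add: delete_edges_def complete_graph_def)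
  show "inj_on ((!) vs) (verts (delete_edges (complete_graph (length vs)) F))"
    unfolding V using assms(1) by (simp add: inj_on_nth)
  show "(!) vs ` verts (delete_edges (complete_graph (length vs)) F) \<subseteq> verts G"
    unfolding V using assms(2) by auto
  fix e assume "e \<in> edges (delete_edges (complete_graph (length vs)) F)"
  then obtain i j where e: "e = {i, j}" "i < length vs" "j < length vs" "i \<noteq> j" "e \<notin> edges F"
    by (auto simp: delete_edges_def complete_graph_def)
  show "(!) vs ` e \<in> edges G"
  proof (cases "i < j")
    case True then show ?thesis using assms(3)[of i j] e by simp
  next
    case False then show ?thesis using assms(3)[of j i] e by (simp add: insert_commute)
  qed
qed

text \<open>
  Let \<open>{a, b}\<close> be the edge shared by the first two triangles. If the third triangle contains it, the
  three triangles form \<open>K\<^sub>5 - K\<^sub>3\<close>; otherwise it joins the two remaining vertices \<open>c\<close> and \<open>d\<close>.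
\<close>

lemma triangle_3_cycle_subgraph:
  assumes t: "triangle_cycle 3 t" "t ` {..<3} \<subseteq> triangles G"
  shows "has_subgraph_isomorphic_to G (complete_graph 4) \<or>
    has_subgraph_isomorphic_to G (delete_edges (complete_graph 5) (complete_graph 3))"
proof -
  have tri: "t 0 \<in> triangles G" "t 1 \<in> triangles G" "t 2 \<in> triangles G" using t(2) by auto
  have adj: "card (t 0 \<inter> t 1) = 2" "card (t 0 \<inter> t 2) = 2" "card (t 1 \<inter> t 2) = 2"
    using triangle_cycle_adj[OF t(1), of 0 1] triangle_cycle_adj[OF t(1), of 0 2] triangle_cycle_adj[OF t(1), of 1 2]
    by simp_all
  obtain a b where ab: "t 0 \<inter> t 1 = {a, b}" "a \<noteq> b" using adj(1) by (auto simp: card_2_iff)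
  have third: "\<exists>c. s = {a, b, c} \<and> c \<noteq> a \<and> c \<noteq> b" if "s \<in> triangles G" "{a, b} \<subseteq> s" for s
  proof -
    have "card (s - {a, b}) = 1" using that ab(2) by (simp add: card_Diff_subset triangles_def)
    then obtain c where "s - {a, b} = {c}" by (auto simp: card_1_singleton_iff)
    then show ?thesis using that(2) by (intro exI[of _ c]) auto
  qed
  obtain c where c: "t 0 = {a, b, c}" "c \<noteq> a" "c \<noteq> b" using third[OF tri(1)] ab(1) by blast
  obtain d where d: "t 1 = {a, b, d}" "d \<noteq> a" "d \<noteq> b" using third[OF tri(2)] ab(1) by blast
  have cd: "c \<noteq> d" using ab c d by auto
  have ver: "a \<in> verts G" "b \<in> verts G" "c \<in> verts G" "d \<in> verts G"
    using tri(1,2) c d by (auto simp: triangles_def)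
  note e0 = triangle_edge[OF tri(1)] and e1 = triangle_edge[OF tri(2)] and e2 = triangle_edge[OF tri(3)]
  have edges: "{a, b} \<in> edges G" "{c, a} \<in> edges G" "{c, b} \<in> edges G" "{d, a} \<in> edges G" "{d, b} \<in> edges G"
    using e0[of a b] e0[of c a] e0[of c b] e1[of d a] e1[of d b] c d ab(2) by auto
  show ?thesis
  proof (cases "{a, b} \<subseteq> t 2")
    case True
    then obtain e where e: "t 2 = {a, b, e}" "e \<noteq> a" "e \<noteq> b" using third[OF tri(3)] by blast
    have "t 0 \<noteq> t 2" "t 1 \<noteq> t 2"
      using adj triangle_cycle_card[OF t(1), of 0] triangle_cycle_card[OF t(1), of 1] by auto
    then have ce: "c \<noteq> e" "d \<noteq> e" using c d e by auto
    have "e \<in> verts G" "{e, a} \<in> edges G" "{e, b} \<in> edges G"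
      using tri(3) e e2[of e a] e2[of e b] by (auto simp: triangles_def)
    have "has_subgraph_isomorphic_to G (delete_edges (complete_graph (length [c, d, e, a, b])) (complete_graph 3))"
    proof (rule complete_minus_subgraph)
      fix i j assume ij: "i < j" "j < length [c, d, e, a, b]" "{i, j} \<notin> edges (complete_graph 3)"
      then have "j = 3 \<and> (i = 0 \<or> i = 1 \<or> i = 2) \<or> j = 4 \<and> (i = 0 \<or> i = 1 \<or> i = 2 \<or> i = 3)"
        by (auto simp: complete_graph_edge)
      then show "{[c, d, e, a, b] ! i, [c, d, e, a, b] ! j} \<in> edges G"
        using edges \<open>{e, a} \<in> edges G\<close> \<open>{e, b} \<in> edges G\<close> by (elim disjE conjE) simp_all
    qed (use ver \<open>e \<in> verts G\<close> ab(2) c d e cd ce in auto)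
    moreover have "length [c, d, e, a, b] = 5" by simp
    ultimately show ?thesis by metis
  next
    case False
    have "c \<in> t 2"
    proof (rule ccontr)
      assume "c \<notin> t 2"
      then have "t 0 \<inter> t 2 = {a, b} \<inter> t 2" using c(1) by auto
      then have "card ({a, b} \<inter> t 2) = card {a, b}" using adj(2) ab(2) by simp
      then show False using False card_subset_eq[of "{a, b}" "{a, b} \<inter> t 2"] by auto
    qed
    moreover have "d \<in> t 2"
    proof (rule ccontr)
      assume "d \<notin> t 2"
      then have "t 1 \<inter> t 2 = {a, b} \<inter> t 2" using d(1) by auto
      then have "card ({a, b} \<inter> t 2) = card {a, b}" using adj(3) ab(2) by simp
      then show False using False card_subset_eq[of "{a, b}" "{a, b} \<inter> t 2"] by auto
    qed
    ultimately have "{c, d} \<in> edges G" using e2[of c d] cd by simp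
    have "has_subgraph_isomorphic_to G (delete_edges (complete_graph (length [c, d, a, b])) (Graph {} {}))"
    proof (rule complete_minus_subgraph)
      fix i j assume ij: "i < j" "j < length [c, d, a, b]"
      then have "j = 1 \<and> i = 0 \<or> j = 2 \<and> (i = 0 \<or> i = 1) \<or> j = 3 \<and> (i = 0 \<or> i = 1 \<or> i = 2)" by auto
      then show "{[c, d, a, b] ! i, [c, d, a, b] ! j} \<in> edges G"
        using edges \<open>{c, d} \<in> edges G\<close> by (elim disjE conjE) simp_all
    qed (use ver ab(2) c d cd in auto)
    moreover have len: "length [c, d, a, b] = 4" by simp
    have "delete_edges (complete_graph (length [c, d, a, b])) (Graph {} {}) = complete_graph 4"
      unfolding len by (simp add: delete_edges_def complete_graph_def)
    ultimately show ?thesis by simp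
  qed
qed

text \<open>
  For \<open>n \<le> 6\<close> the strip itself embeds, and the bound on \<open>n\<close> leaves few starting graphs. For larger
  \<open>n\<close> some stickings may be needed.
\<close>

lemma (in triangle_strip) strip_forbidden_subgraph:
  assumes G: "simple_graph G" and tri: "\<And>i. T i \<in> triangles G" and s0: "switch 0"
  shows "\<exists>H. H \<in> forbidden_subgraphs n \<and> has_subgraph_isomorphic_to G H"
proof -
  let ?s = "map switch [0..<n]"
  have len: "length ?s = n" by simp
  obtain H0 m a b H S where base: "(H0, m) \<in> base_graphs" "m \<le> n"
    and spl: "(H, S) \<in> splittings H0 m (n - m)" and str: "strip_word ?s a b H S"
    using realizable_switches[OF s0] unfolding realizable_def len by blast
  have n5: "5 \<le> n" using realizable_length[OF realizable_switches[OF s0]] by simp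
  have simple: "simple_graph H" and V: "verts H = a ` {..<n}" and S: "S \<subseteq> triangles H"
    and cover: "\<forall>e\<in>edges H. \<exists>t\<in>S. e \<subseteq> t"
    and Sim: "strip_triangle n a b ` {..<n} = S" and scyc: "triangle_cycle n (strip_triangle n a b)"
    using str unfolding strip_word_def len by auto
  obtain f where f: "\<And>i. i < n \<Longrightarrow> f (a i) = x i" "\<And>i. i < n \<Longrightarrow> f ` strip_triangle n a b i = T i"
    using strip_map[OF str s0] by blast
  have local_f: "local_map f S" using local_mapI[OF scyc cyc f(2)] unfolding Sim .
  have icyc: "induced_cycle (triangle_graph H) n S" using strip_word_induced_cycle[OF str] n5 by simp
  have "x i \<in> verts G" for i using tri[of i] T[of i] by (auto simp: triangles_def)
  then have f_verts: "f ` verts H \<subseteq> verts G" unfolding V using f(1) by auto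
  have f_edges: "\<forall>e\<in>edges H. f ` e \<in> edges G"
  proof
    fix e assume e: "e \<in> edges H"
    then obtain t where t: "t \<in> S" "e \<subseteq> t" using cover by blast
    then obtain i where i: "i < n" "t = strip_triangle n a b i" using Sim by blast
    obtain c d where cd: "e = {c, d}" "c \<noteq> d" using simple_edge[OF simple e] by blast
    have "f c \<noteq> f d" using local_f t cd unfolding local_map_def by (auto dest: inj_onD)
    moreover have "{f c, f d} \<subseteq> T i" using f(2)[OF i(1)] i(2) t(2) cd by auto
    ultimately show "f ` e \<in> edges G" using triangle_edge[OF tri] cd by simp
  qed
  show ?thesis
  proof (cases "7 \<le> n")
    case True
    obtain H' S' where stick: "weak_vertex_sticking\<^sup>*\<^sup>* (H, S) (H', S')" and sub: "has_subgraph_isomorphic_to G H'"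
      using stickings_to_subgraph[OF simple icyc n4 cover local_f f_verts f_edges] by blast
    have "(H, S) \<in> split_graphs n" using base spl True by (subst split_graphs_eq) auto
    then have "(H', S') \<in> stuck_graphs n" using stick unfolding stuck_graphs_def by blast
    then have "H' \<in> forbidden_subgraphs n" using True by (force simp: forbidden_subgraphs_def)
    then show ?thesis using sub by blast
  next
    case False
    have "inj_on f (verts H)"
    proof (rule inj_onI, rule ccontr)
      fix c d assume "c \<in> verts H" "d \<in> verts H" "f c = f d" "c \<noteq> d"
      then have "8 \<le> length ?s"
        using far_vertices_strip[OF str _ _ _ local_map_far[OF local_f simple S cover]] n5 by simp
      then show False using False by simp
    qed
    then have sub: "has_subgraph_isomorphic_to G H"
      unfolding has_subgraph_iff_embedding[OF simple] using f_verts f_edges by blast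
    from base consider "H0 = square_graph (cycle_graph m)" "5 \<le> m" | "m = 6" "(H0, 6) \<in> base_graphs"
      by (auto simp: base_graphs_def)
    then have "H \<in> forbidden_subgraphs n"
    proof cases
      case 1
      then have "m = n \<and> n = 5 \<or> m = n \<and> n = 6 \<or> m = 5 \<and> n = 6" using base(2) False by linarith
      then show ?thesis
      proof (elim disjE conjE)
        assume "m = 5" "n = 6"
        then have "H \<in> fst ` splittings (square_graph (cycle_graph 5)) 5 1" using spl 1(1) by force
        then show ?thesis using \<open>n = 6\<close> by (simp add: forbidden_subgraphs_def)
      qed (use spl 1 in \<open>auto simp: splittings_0 forbidden_subgraphs_def\<close>)
    next
      case 2
      then have "n = 6" using base(2) False by simp
      then have "H = H0" using spl 2(1) by (simp add: splittings_0)
      then show ?thesis using 2(2) \<open>n = 6\<close> by (auto simp: base_graphs_def forbidden_subgraphs_def)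
    qed
    then show ?thesis using sub by blast
  qed
qed

lemma induced_cycle_forbidden_subgraph:
  assumes G: "simple_graph G" and S: "induced_cycle (triangle_graph G) n S"
  shows "\<exists>H. H \<in> forbidden_subgraphs n \<and> has_subgraph_isomorphic_to G H"
proof -
  obtain t where n: "3 \<le> n" and t: "triangle_cycle n t" "t ` {..<n} \<subseteq> triangles G"
    using S unfolding induced_cycle_iff[OF G] by blast
  show ?thesis
  proof (cases "n = 3")
    case True
    then show ?thesis using triangle_3_cycle_subgraph[of t G] t by (auto simp: forbidden_subgraphs_def)
  next
    case False
    then have n4: "4 \<le> n" using n by simp
    obtain x z where "triangle_strip n (\<lambda>i. t (i mod n)) x z" using triangle_strip_exists[OF n4 t(1)] by blast
    then interpret triangle_strip n "\<lambda>i. t (i mod n)" x z .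
    have tri: "t (i mod n) \<in> triangles G" for i using t(2) n4 by auto
    show ?thesis
    proof (cases "\<exists>k. switch k")
      case True
      then obtain k where k: "switch k" by blast
      \<comment> \<open>the word is read off from a switch onwards\<close>
      interpret shifted: triangle_strip n "\<lambda>i. t ((i + k) mod n)" "\<lambda>i. x (i + k)" "\<lambda>i. z (i + k)"
        by (rule shift)
      have "shifted.switch 0" using k by (simp add: shifted.switch_def switch_def)
      then show ?thesis using shifted.strip_forbidden_subgraph[OF G tri] by blast
    next
      case False
      then have "has_subgraph_isomorphic_to G (wheel_graph n)" using wheel_subgraph[OF G tri] by blast
      moreover have "wheel_graph n \<in> forbidden_subgraphs n" using n4 by (auto simp: forbidden_subgraphs_def)
      ultimately show ?thesis by blast
    qed
  qed
qed

theorem theorem13: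
  fixes G :: "'a graph" and n :: nat
  assumes "simple_graph G" and "3 \<le> n"
  shows "(\<nexists>S. induced_cycle (triangle_graph G) n S) \<longleftrightarrow>
         (\<nexists>H. H \<in> forbidden_subgraphs n \<and> has_subgraph_isomorphic_to G H)"
  using induced_cycle_forbidden_subgraph[OF assms(1)] forbidden_induced_cycle[OF assms(2)]
    induced_cycle_supergraph[OF assms(1)] by blast

end
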